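(* Let $R$ be a finite ring of characteristic $n$. Then $R$ is a Frobenius ring if and only if $R$ is a non projective Frobenius $\mathbb{Z}_n$-algebra.
   Context: All rings are unital and possibly noncommutative; $\mathbb{Z}_n=\mathbb{Z}/n\mathbb{Z}$, which is a commutative Frobenius ring. A left and right artinian ring $A$ with Jacobson radical $J$ is called Frobenius if $\operatorname{Soc}({}_AA)\cong A/J$ as left $A$-modules and $\operatorname{Soc}(A_A)\cong A/J$ as right $A$-modules, where $\operatorname{Soc}$ denotes the socle. Let $R$ be an algebra over a commutative Frobenius ring $K$. A $K$-bilinear form $\langle -,-\rangle : R\times R\to K$ is associative if $\langle bb',b''\rangle=\langle b,b'b''\rangle$ for all $b,b',b''\in R$. It is non degenerate if both maps $\alpha,\beta: R\to R^*=\operatorname{Hom}_K(R,K)$, $\alpha(b)(b')=\langle b,b'\rangle=\beta(b')(b)$, are injective. The algebra $R$ is called non projective Frobenius over $K$ if $R$ is finitely generated as a $K$-module and there exists an associative non degenerate $K$-bilinear form $R\times R\to K$ ("non projective" means "not necessarily projective" as a $K$-module). *)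

theory Defs
  imports "HOL-Algebra.IntRing" "HOL-Algebra.Multiplicative_Group"
begin

text \<open>
  The distribution's locale for modules assumes a commutative base ring. Left modules over an
  arbitrary ring \<open>R\<close> are represented below by the same records and by the same notion of submodule,
  which does not depend on commutativity. Right modules over \<open>R\<close> are left modules over the opposite
  ring. The multiplicative part of a module record plays no role in these notions.
\<close>

definition opp_ring :: "('a, 'm) ring_scheme \<Rightarrow> 'a ring" where
  "opp_ring R = \<lparr>carrier = carrier R, monoid.mult = (\<lambda>x y. y \<otimes>\<^bsub>R\<^esub> x), one = \<one>\<^bsub>R\<^esub>,
                 ring.zero = \<zero>\<^bsub>R\<^esub>, add = (\<oplus>\<^bsub>R\<^esub>)\<rparr>"

definition regular_module :: "('a, 'm) ring_scheme \<Rightarrow> ('a, 'a) module" where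
  "regular_module R = \<lparr>carrier = carrier R, monoid.mult = (\<otimes>\<^bsub>R\<^esub>), one = \<one>\<^bsub>R\<^esub>,
                       ring.zero = \<zero>\<^bsub>R\<^esub>, add = (\<oplus>\<^bsub>R\<^esub>), smult = (\<otimes>\<^bsub>R\<^esub>)\<rparr>"

definition simple_submodule ::
    "'b set \<Rightarrow> ('a, 'm) ring_scheme \<Rightarrow> ('a, 'b, 'n) module_scheme \<Rightarrow> bool" where
  "simple_submodule S R M \<longleftrightarrow> submodule S R M \<and> S \<noteq> {\<zero>\<^bsub>M\<^esub>} \<and>
     (\<forall>N. submodule N R M \<and> N \<subseteq> S \<longrightarrow> N = {\<zero>\<^bsub>M\<^esub>} \<or> N = S)"

definition maximal_submodule ::
    "'b set \<Rightarrow> ('a, 'm) ring_scheme \<Rightarrow> ('a, 'b, 'n) module_scheme \<Rightarrow> bool" where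
  "maximal_submodule S R M \<longleftrightarrow> submodule S R M \<and> S \<noteq> carrier M \<and>
     (\<forall>N. submodule N R M \<and> S \<subseteq> N \<longrightarrow> N = S \<or> N = carrier M)"

text \<open>The sum of all simple submodules.\<close>

definition socle :: "('a, 'm) ring_scheme \<Rightarrow> ('a, 'b, 'n) module_scheme \<Rightarrow> 'b set" where
  "socle R M = generate (add_monoid M) (\<Union>{S. simple_submodule S R M})"

definition artinian_module ::
    "('a, 'm) ring_scheme \<Rightarrow> ('a, 'b, 'n) module_scheme \<Rightarrow> bool" where
  "artinian_module R M \<longleftrightarrow>
     (\<forall>S :: nat \<Rightarrow> 'b set. (\<forall>i. submodule (S i) R M \<and> S (Suc i) \<subseteq> S i) \<longrightarrow>
        (\<exists>m. \<forall>i\<ge>m. S i = S m))"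

definition quotient_module ::
    "('a, 'b, 'n) module_scheme \<Rightarrow> 'b set \<Rightarrow> ('a, 'b set) module" where
  "quotient_module M N =
     \<lparr>carrier = a_rcosets\<^bsub>M\<^esub> N, monoid.mult = undefined, one = undefined, ring.zero = N,
      add = set_add M, smult = (\<lambda>r C. \<Union>x\<in>C. N +>\<^bsub>M\<^esub> (r \<odot>\<^bsub>M\<^esub> x))\<rparr>"

definition module_isomorphic ::
    "('a, 'm) ring_scheme \<Rightarrow> ('a, 'b, 'n) module_scheme \<Rightarrow> ('a, 'c, 'k) module_scheme \<Rightarrow> bool" where
  "module_isomorphic R M N \<longleftrightarrow>
     (\<exists>f. bij_betw f (carrier M) (carrier N) \<and>
        (\<forall>x\<in>carrier M. \<forall>y\<in>carrier M. f (x \<oplus>\<^bsub>M\<^esub> y) = f x \<oplus>\<^bsub>N\<^esub> f y) \<and>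
        (\<forall>r\<in>carrier R. \<forall>x\<in>carrier M. f (r \<odot>\<^bsub>M\<^esub> x) = r \<odot>\<^bsub>N\<^esub> f x))"

text \<open>
  The intersection of all maximal left ideals; intersecting with the carrier only matters for the
  zero ring, which has none and is its own radical.
\<close>

definition jacobson_radical :: "('a, 'm) ring_scheme \<Rightarrow> 'a set" where
  "jacobson_radical R =
     carrier R \<inter> \<Inter>{I. maximal_submodule I R (regular_module R)}"

definition frobenius_ring :: "('a, 'm) ring_scheme \<Rightarrow> bool" where
  "frobenius_ring A \<longleftrightarrow>
     ring A \<and>
     artinian_module A (regular_module A) \<and>
     artinian_module (opp_ring A) (regular_module (opp_ring A)) \<and>
     module_isomorphic A
       ((regular_module A)\<lparr>carrier := socle A (regular_module A)\<rparr>)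
       (quotient_module (regular_module A) (jacobson_radical A)) \<and>
     module_isomorphic (opp_ring A)
       ((regular_module (opp_ring A))
          \<lparr>carrier := socle (opp_ring A) (regular_module (opp_ring A))\<rparr>)
       (quotient_module (regular_module (opp_ring A)) (jacobson_radical A))"

text \<open>The distribution's locale for algebras requires the algebra itself to be commutative.\<close>

locale nc_algebra = module K R + ring R for K (structure) and R (structure) +
  assumes smult_mult_left:
      "\<lbrakk>k \<in> carrier K; x \<in> carrier R; y \<in> carrier R\<rbrakk> \<Longrightarrow>
        (k \<odot>\<^bsub>R\<^esub> x) \<otimes>\<^bsub>R\<^esub> y = k \<odot>\<^bsub>R\<^esub> (x \<otimes>\<^bsub>R\<^esub> y)"
    and smult_mult_right:
      "\<lbrakk>k \<in> carrier K; x \<in> carrier R; y \<in> carrier R\<rbrakk> \<Longrightarrow>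
        x \<otimes>\<^bsub>R\<^esub> (k \<odot>\<^bsub>R\<^esub> y) = k \<odot>\<^bsub>R\<^esub> (x \<otimes>\<^bsub>R\<^esub> y)"

definition finitely_generated_module ::
    "('a, 'm) ring_scheme \<Rightarrow> ('a, 'b, 'n) module_scheme \<Rightarrow> bool" where
  "finitely_generated_module K M \<longleftrightarrow>
     (\<exists>S. finite S \<and> S \<subseteq> carrier M \<and> \<Inter>{N. submodule N K M \<and> S \<subseteq> N} = carrier M)"

definition dual_module ::
    "('a, 'm) ring_scheme \<Rightarrow> ('a, 'b, 'n) module_scheme \<Rightarrow> ('b \<Rightarrow> 'a) set" where
  "dual_module K M =
     {f \<in> carrier M \<rightarrow>\<^sub>E carrier K.
        (\<forall>x\<in>carrier M. \<forall>y\<in>carrier M. f (x \<oplus>\<^bsub>M\<^esub> y) = f x \<oplus>\<^bsub>K\<^esub> f y) \<and>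
        (\<forall>k\<in>carrier K. \<forall>x\<in>carrier M. f (k \<odot>\<^bsub>M\<^esub> x) = k \<otimes>\<^bsub>K\<^esub> f x)}"

definition form_alpha ::
    "('a, 'b, 'n) module_scheme \<Rightarrow> ('b \<Rightarrow> 'b \<Rightarrow> 'k) \<Rightarrow> 'b \<Rightarrow> 'b \<Rightarrow> 'k" where
  "form_alpha R B b = (\<lambda>b'\<in>carrier R. B b b')"

definition form_beta ::
    "('a, 'b, 'n) module_scheme \<Rightarrow> ('b \<Rightarrow> 'b \<Rightarrow> 'k) \<Rightarrow> 'b \<Rightarrow> 'b \<Rightarrow> 'k" where
  "form_beta R B b' = (\<lambda>b\<in>carrier R. B b b')"

text \<open>Linearity of \<open>B\<close> in its second and in its first argument.\<close>

definition bilinear_form ::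
    "('a, 'm) ring_scheme \<Rightarrow> ('a, 'b, 'n) module_scheme \<Rightarrow> ('b \<Rightarrow> 'b \<Rightarrow> 'a) \<Rightarrow> bool" where
  "bilinear_form K R B \<longleftrightarrow>
     (\<forall>b\<in>carrier R. form_alpha R B b \<in> dual_module K R) \<and>
     (\<forall>b\<in>carrier R. form_beta R B b \<in> dual_module K R)"

definition associative_form ::
    "('a, 'b, 'n) module_scheme \<Rightarrow> ('b \<Rightarrow> 'b \<Rightarrow> 'k) \<Rightarrow> bool" where
  "associative_form R B \<longleftrightarrow>
     (\<forall>b\<in>carrier R. \<forall>b'\<in>carrier R. \<forall>b''\<in>carrier R.
        B (b \<otimes>\<^bsub>R\<^esub> b') b'' = B b (b' \<otimes>\<^bsub>R\<^esub> b''))"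

definition non_degenerate_form ::
    "('a, 'b, 'n) module_scheme \<Rightarrow> ('b \<Rightarrow> 'b \<Rightarrow> 'k) \<Rightarrow> bool" where
  "non_degenerate_form R B \<longleftrightarrow>
     inj_on (form_alpha R B) (carrier R) \<and> inj_on (form_beta R B) (carrier R)"

definition non_projective_frobenius ::
    "('a, 'm) ring_scheme \<Rightarrow> ('a, 'b, 'n) module_scheme \<Rightarrow> bool" where
  "non_projective_frobenius K R \<longleftrightarrow>
     frobenius_ring K \<and> nc_algebra K R \<and> finitely_generated_module K R \<and>
     (\<exists>B. bilinear_form K R B \<and> associative_form R B \<and> non_degenerate_form R B)"

text \<open>The additive order of the unit, which the library takes to be \<open>0\<close> if it is infinite.\<close>

definition ring_char :: "('a, 'm) ring_scheme \<Rightarrow> nat" where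
  "ring_char R = group.ord (add_monoid R) \<one>\<^bsub>R\<^esub>"

text \<open>
  \<open>R\<close> as an algebra over \<^term>\<open>ZFact (int (ring_char R))\<close>: a residue class acts as any integer
  representing it. The lemmas below show that this is well defined, that it is an algebra, and that
  no other algebra structure over that base exists on \<open>R\<close>.
\<close>

definition char_algebra :: "('a, 'm) ring_scheme \<Rightarrow> (int set, 'a) module" where
  "char_algebra R = \<lparr>carrier = carrier R, monoid.mult = (\<otimes>\<^bsub>R\<^esub>), one = \<one>\<^bsub>R\<^esub>,
     ring.zero = \<zero>\<^bsub>R\<^esub>, add = (\<oplus>\<^bsub>R\<^esub>), smult = (\<lambda>C x. add_pow R (SOME k. k \<in> C) x)\<rparr>"

lemma char_algebra_simps [simp]:
  "carrier (char_algebra R) = carrier R"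
  "monoid.mult (char_algebra R) = monoid.mult R"
  "one (char_algebra R) = one R"
  "ring.zero (char_algebra R) = ring.zero R"
  "add (char_algebra R) = add R"
  by (simp_all add: char_algebra_def)

lemma (in ring) ring_char_dvd_imp:
  assumes "int (ring_char R) dvd k" "x \<in> carrier R"
  shows "add_pow R k x = \<zero>"
proof -
  have "add_pow R k \<one> = \<zero>"
    using add.int_pow_eq_id[of \<one> k] assms(1) by (simp add: ring_char_def)
  then have "(add_pow R k \<one>) \<otimes> x = \<zero>"
    using assms(2) by simp
  then show ?thesis
    using add_pow_ldistr_int[of \<one> x k] assms(2) by simp
qed

lemma ZFact_classD:
  assumes "C \<in> carrier (ZFact m)" "k \<in> C"
  shows "C = Idl\<^bsub>\<Z>\<^esub> {m} +>\<^bsub>\<Z>\<^esub> k" and "l \<in> C \<longleftrightarrow> m dvd l - k"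
proof -
  obtain a where C: "C = Idl\<^bsub>\<Z>\<^esub> {m} +>\<^bsub>\<Z>\<^esub> a"
    using assms(1) by (auto simp: ZFact_defs A_RCOSETS_def')
  have mem: "y \<in> Idl\<^bsub>\<Z>\<^esub> {m} +>\<^bsub>\<Z>\<^esub> z \<longleftrightarrow> m dvd y - z" for y z
    by (auto simp: a_r_coset_def' int_Idl dvd_def algebra_simps)
  have *: "m dvd y - a \<longleftrightarrow> m dvd y - k" for y
    using dvd_add_right_iff[of m "k - a" "y - k"] assms(2) C mem by simp
  show "C = Idl\<^bsub>\<Z>\<^esub> {m} +>\<^bsub>\<Z>\<^esub> k" and "l \<in> C \<longleftrightarrow> m dvd l - k"
    using C mem * by auto
qed

lemma ZFact_class_nonempty:
  assumes "C \<in> carrier (ZFact m)"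
  shows "(SOME k. k \<in> C) \<in> C"
proof -
  obtain a where "C = Idl\<^bsub>\<Z>\<^esub> {m} +>\<^bsub>\<Z>\<^esub> a"
    using assms by (auto simp: ZFact_defs A_RCOSETS_def')
  then have "a \<in> C"
    by (auto simp: a_r_coset_def' int_Idl intro: exI[of _ 0])
  then show ?thesis
    by (rule someI)
qed

lemma (in ring) char_algebra_smult:
  assumes "C \<in> carrier (ZFact (int (ring_char R)))" "k \<in> C" "x \<in> carrier R"
  shows "C \<odot>\<^bsub>char_algebra R\<^esub> x = add_pow R k x"
proof -
  define l where "l = (SOME k. k \<in> C)"
  have "l \<in> C"
    unfolding l_def by (rule ZFact_class_nonempty[OF assms(1)])
  then have "int (ring_char R) dvd l - k"
    using ZFact_classD(2)[OF assms(1,2)] by simp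
  then have "add_pow R (l - k) x = \<zero>"
    using ring_char_dvd_imp assms(3) by simp
  moreover have "add_pow R l x = add_pow R (l - k) x \<oplus> add_pow R k x"
    using add.int_pow_mult[of x "l - k" k] assms(3) by simp
  ultimately show ?thesis
    using assms(3) by (simp add: char_algebra_def l_def[symmetric])
qed

lemma ZFact_class_add_mult:
  assumes "C \<in> carrier (ZFact m)" "D \<in> carrier (ZFact m)" "k \<in> C" "l \<in> D"
  shows "k + l \<in> C \<oplus>\<^bsub>ZFact m\<^esub> D" "k * l \<in> C \<otimes>\<^bsub>ZFact m\<^esub> D"
proof -
  interpret I: ideal "Idl\<^bsub>\<Z>\<^esub> {m}" \<Z>
    by (rule int.genideal_ideal) simp
  have CD: "C = Idl\<^bsub>\<Z>\<^esub> {m} +>\<^bsub>\<Z>\<^esub> k" "D = Idl\<^bsub>\<Z>\<^esub> {m} +>\<^bsub>\<Z>\<^esub> l"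
    using ZFact_classD(1) assms by blast+
  have self: "a \<in> Idl\<^bsub>\<Z>\<^esub> {m} +>\<^bsub>\<Z>\<^esub> a" for a
    by (auto simp: a_r_coset_def' int_Idl intro: exI[of _ 0])
  show "k + l \<in> C \<oplus>\<^bsub>ZFact m\<^esub> D"
    using I.a_rcos_sum[of k l] self[of "k + l"] by (simp add: CD ZFact_defs)
  show "k * l \<in> C \<otimes>\<^bsub>ZFact m\<^esub> D"
    using I.rcoset_mult_add[of k l] self[of "k * l"] by (simp add: CD ZFact_defs)
qed

lemma ZFact_one_mem: "1 \<in> \<one>\<^bsub>ZFact m\<^esub>"
  by (auto simp: ZFact_defs a_r_coset_def' int_Idl intro: exI[of _ 0])

lemma (in ring) nc_algebra_char_algebra:
  "nc_algebra (ZFact (int (ring_char R))) (char_algebra R)"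
proof -
  let ?K = "ZFact (int (ring_char R))"
  let ?A = "char_algebra R"
  interpret K: cring ?K
    by (rule ZFact_is_cring)
  have A: "ring ?A"
    by (rule ringI)
      (auto intro!: abelian_groupI monoidI simp: a_assoc m_assoc a_lcomm a_comm l_distr r_distr
        intro: add.l_inv_ex)
  have rep: "\<exists>k. k \<in> C" if "C \<in> carrier ?K" for C
    using ZFact_class_nonempty[OF that] by blast
  have M: "module ?K ?A"
  proof (rule moduleI)
    show "cring ?K" "abelian_group ?A"
      using A by (simp_all add: K.is_cring ring.is_abelian_group)
  next
    fix C x assume C: "C \<in> carrier ?K" and x: "x \<in> carrier ?A"
    then show "C \<odot>\<^bsub>?A\<^esub> x \<in> carrier ?A"
      using rep[OF C] char_algebra_smult[OF C] by auto
  next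
    fix C D x assume C: "C \<in> carrier ?K" and D: "D \<in> carrier ?K" and x: "x \<in> carrier ?A"
    obtain k l where kl: "k \<in> C" "l \<in> D"
      using rep C D by blast
    note [simp] = char_algebra_smult[OF C kl(1)] char_algebra_smult[OF D kl(2)]
      char_algebra_smult[OF K.add.m_closed[OF C D] ZFact_class_add_mult(1)[OF C D kl]]
      char_algebra_smult[OF K.m_closed[OF C D] ZFact_class_add_mult(2)[OF C D kl]]
    show "(C \<oplus>\<^bsub>?K\<^esub> D) \<odot>\<^bsub>?A\<^esub> x = C \<odot>\<^bsub>?A\<^esub> x \<oplus>\<^bsub>?A\<^esub> D \<odot>\<^bsub>?A\<^esub> x"
      using x add.int_pow_mult[of x k l] by simp
    show "(C \<otimes>\<^bsub>?K\<^esub> D) \<odot>\<^bsub>?A\<^esub> x = C \<odot>\<^bsub>?A\<^esub> (D \<odot>\<^bsub>?A\<^esub> x)"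
      using x add.int_pow_pow[of x k l] by (simp add: mult.commute)
  next
    fix C x y assume C: "C \<in> carrier ?K" and xy: "x \<in> carrier ?A" "y \<in> carrier ?A"
    obtain k where k: "k \<in> C"
      using rep C by blast
    show "C \<odot>\<^bsub>?A\<^esub> (x \<oplus>\<^bsub>?A\<^esub> y) = C \<odot>\<^bsub>?A\<^esub> x \<oplus>\<^bsub>?A\<^esub> C \<odot>\<^bsub>?A\<^esub> y"
      using xy add.int_pow_distrib[of x y k] by (simp add: char_algebra_smult[OF C k])
  next
    fix x assume "x \<in> carrier ?A"
    then show "\<one>\<^bsub>?K\<^esub> \<odot>\<^bsub>?A\<^esub> x = x"
      using add.int_pow_1[of x] by (simp add: char_algebra_smult[OF K.one_closed ZFact_one_mem])
  qed
  show ?thesis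
  proof (intro nc_algebra.intro nc_algebra_axioms.intro M A)
    fix C x y assume C: "C \<in> carrier ?K" and xy: "x \<in> carrier ?A" "y \<in> carrier ?A"
    obtain k where k: "k \<in> C"
      using rep C by blast
    show "(C \<odot>\<^bsub>?A\<^esub> x) \<otimes>\<^bsub>?A\<^esub> y = C \<odot>\<^bsub>?A\<^esub> (x \<otimes>\<^bsub>?A\<^esub> y)"
      using xy add_pow_ldistr_int[of x y k] by (simp add: char_algebra_smult[OF C k])
    show "x \<otimes>\<^bsub>?A\<^esub> (C \<odot>\<^bsub>?A\<^esub> y) = C \<odot>\<^bsub>?A\<^esub> (x \<otimes>\<^bsub>?A\<^esub> y)"
      using xy add_pow_rdistr_int[of x y k] by (simp add: char_algebra_smult[OF C k])
  qed
qed

lemma (in ring) char_algebra_smult_unique: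
  assumes "module (ZFact (int (ring_char R))) A"
    and "carrier A = carrier R" "ring.zero A = \<zero>" "add A = add R"
    and C: "C \<in> carrier (ZFact (int (ring_char R)))" and x: "x \<in> carrier R"
  shows "C \<odot>\<^bsub>A\<^esub> x = C \<odot>\<^bsub>char_algebra R\<^esub> x"
proof -
  let ?K = "ZFact (int (ring_char R))"
  interpret A: module ?K A by fact
  define c where "c k = Idl\<^bsub>\<Z>\<^esub> {int (ring_char R)} +>\<^bsub>\<Z>\<^esub> k" for k :: int
  interpret I: ideal "Idl\<^bsub>\<Z>\<^esub> {int (ring_char R)}" \<Z>
    by (rule int.genideal_ideal) simp
  have cc: "c k \<in> carrier ?K" for k
    by (auto simp: c_def ZFact_defs A_RCOSETS_def')
  have c_add: "c (k + l) = c k \<oplus>\<^bsub>?K\<^esub> c l" for k l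
    using I.a_rcos_sum[of k l] by (simp add: c_def ZFact_defs)
  have c1: "c 1 = \<one>\<^bsub>?K\<^esub>"
    by (simp add: c_def ZFact_defs)
  have c0: "c 0 = \<zero>\<^bsub>?K\<^esub>"
    using c_add[of 0 0] cc[of 0] A.R.add.l_cancel_one' by fastforce
  have cl: "c k \<odot>\<^bsub>A\<^esub> x \<in> carrier R" for k
    using A.smult_closed[OF cc, of x k] assms(2) x by simp
  have add: "c (k + l) \<odot>\<^bsub>A\<^esub> x = c k \<odot>\<^bsub>A\<^esub> x \<oplus> c l \<odot>\<^bsub>A\<^esub> x" for k l
    using A.smult_l_distr[OF cc cc, of x k l] assms(2,4) x by (simp add: c_add)
  have one: "c 1 \<odot>\<^bsub>A\<^esub> x = x"
    using A.smult_one[of x] assms(2) x by (simp add: c1)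
  have nat: "c (int n) \<odot>\<^bsub>A\<^esub> x = add_pow R (int n) x" for n
  proof (induction n)
    case 0
    then show ?case
      using A.smult_l_null[of x] assms(2,3) x by (simp add: c0 add_pow_def)
  next
    case (Suc n)
    then show ?case
      using add[of "int n" 1] one add.int_pow_mult[of x "int n" 1] add.int_pow_1[of x] x
      by (simp add: add.commute)
  qed
  have p0: "add_pow R (0 :: int) x = \<zero>"
    by (simp add: add_pow_def)
  have "c k \<odot>\<^bsub>A\<^esub> x = add_pow R k x" for k
  proof (cases "0 \<le> k")
    case True
    then show ?thesis using nat[of "nat k"] by simp
  next
    case False
    have "c k \<odot>\<^bsub>A\<^esub> x \<oplus> add_pow R (- k) x = \<zero>"
      using add[of k "- k"] nat[of "nat (- k)"] nat[of 0] p0 False by simp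
    moreover have "add_pow R k x \<oplus> add_pow R (- k) x = \<zero>"
      using add.int_pow_mult[of x k "- k"] p0 x by simp
    ultimately show ?thesis
      using cl[of k] x by (metis add.int_pow_closed add.right_cancel)
  qed
  moreover obtain k where "k \<in> C"
    using ZFact_class_nonempty[OF C] by blast
  ultimately show ?thesis
    using ZFact_classD(1)[OF C] char_algebra_smult[OF C _ x] unfolding c_def by metis
qed

end

theory Submission
  imports Defs Complex_Main
begin

text \<open>
  Call an additive character \<open>\<epsilon> : R \<rightarrow> \<complex>\<^sup>\<times>\<close> faithful if its kernel contains no nonzero left ideal.
  Since \<open>\<int>\<^sub>n\<close> is the group of complex \<open>n\<close>-th roots of unity, an associative non degenerate form
  with values in \<open>\<int>\<^sub>n\<close> is the same as a faithful character, via \<open>\<langle>x, y\<rangle> = \<epsilon> (x y)\<close>; counting shows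
  that the left and the right version of faithfulness agree. So \<open>R\<close> has to be shown to be Frobenius
  if and only if it has a faithful character.

  Write \<open>J\<close> for the Jacobson radical. The quotient \<open>R/J\<close> always has a faithful character \<open>\<chi>\<close>, by
  a union bound on each minimal two-sided ideal. If
  \<open>Soc(R) \<cong> R/J\<close>, transport \<open>\<chi>\<close> to the socle and extend it to \<open>R\<close>: the result is faithful because
  every nonzero left ideal contains a simple one. Conversely, a faithful \<open>\<epsilon>\<close> makes every character
  of \<open>R\<close> a translate of \<open>\<epsilon>\<close>, so \<open>\<chi>\<close> pulled back to \<open>R\<close> has the form \<open>\<epsilon> (\<cdot> s)\<close>; then \<open>x \<mapsto> x s\<close> has
  kernel \<open>J\<close>, and comparing cardinalities shows that its image is the socle.
\<close>

subsection \<open>Additive characters of finite abelian groups\<close>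

text \<open>Characters take complex values, and not values in \<open>ZFact (int n)\<close>, because
  sums of roots of unity count: every comparison of cardinalities below rests on |T| |T'| = |R|,
  where T' is the set of characters trivial on the subgroup T. The ring Z_n returns only when forms
  are translated into characters.

  The obstacle is the character of R/J. Wedderburn-Artin would give it on each matrix block as a
  trace followed by a character of a finite field. Here only semiprimeness of R/J is extracted (x R
  x = 0 forces x = 0), and a count replaces the structure theory. That count plays right multiples
  of one element against left multiples of all others, so it may go through for R or only for its
  opposite ring; the symmetry of faithfulness brings the result back.

  Frobenius rings are defined by two-sided conditions, while the lemmas speak of left ideals. The
  right half is the left half for \<open>opp_ring R\<close>, with the same character. Since one
  radical J serves both sides of the definition, the left and the right radical have to be
  identified, which finiteness allows through one-sided inverses of 1 - j.\<close>

definition character_on :: "('a, 'm) ring_scheme \<Rightarrow> 'a set \<Rightarrow> ('a \<Rightarrow> complex) \<Rightarrow> bool" where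
  "character_on G H \<chi> \<longleftrightarrow>
     (\<forall>x\<in>H. \<chi> x \<noteq> 0) \<and> (\<forall>x\<in>H. \<forall>y\<in>H. \<chi> (x \<oplus>\<^bsub>G\<^esub> y) = \<chi> x * \<chi> y)"

text \<open>Extensionality fixes the values outside the carrier, so that the characters form a
  finite set whose cardinality is that of the dual group.\<close>

definition add_chars :: "('a, 'm) ring_scheme \<Rightarrow> ('a \<Rightarrow> complex) set" where
  "add_chars G = {\<chi> \<in> extensional (carrier G). character_on G (carrier G) \<chi>}"

lemma character_onI:
  assumes "\<And>x. x \<in> H \<Longrightarrow> \<chi> x \<noteq> 0"
    and "\<And>x y. x \<in> H \<Longrightarrow> y \<in> H \<Longrightarrow> \<chi> (x \<oplus>\<^bsub>G\<^esub> y) = \<chi> x * \<chi> y"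
  shows "character_on G H \<chi>"
  using assms by (simp add: character_on_def)

lemma character_on_nonzero: "character_on G H \<chi> \<Longrightarrow> x \<in> H \<Longrightarrow> \<chi> x \<noteq> 0"
  and character_on_add:
    "character_on G H \<chi> \<Longrightarrow> x \<in> H \<Longrightarrow> y \<in> H \<Longrightarrow> \<chi> (x \<oplus>\<^bsub>G\<^esub> y) = \<chi> x * \<chi> y"
  by (simp_all add: character_on_def)

lemma character_on_subset: "character_on G H \<chi> \<Longrightarrow> K \<subseteq> H \<Longrightarrow> character_on G K \<chi>"
  by (auto simp: character_on_def)

lemma add_charsD: "\<chi> \<in> add_chars G \<Longrightarrow> character_on G (carrier G) \<chi>"
  by (simp add: add_chars_def)

text \<open>Divisibility of the multiplicative group of the complex numbers, on which the extension
  of characters rests.\<close>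

lemma complex_nth_root_exists:
  fixes z :: complex
  assumes "z \<noteq> 0" "k > 0"
  obtains c where "c ^ k = z"
proof -
  define c where "c = rcis (root k (cmod z)) (Arg z / real k)"
  have "c ^ k = z"
    using assms by (simp add: c_def DeMoivre2 rcis_cmod_Arg)
  then show ?thesis by (rule that)
qed

context abelian_group
begin

lemma restrict_in_add_chars:
  "character_on G (carrier G) \<chi> \<Longrightarrow> restrict \<chi> (carrier G) \<in> add_chars G"
  by (simp add: add_chars_def character_on_def)

lemma add_char_zero: "\<chi> \<in> add_chars G \<Longrightarrow> \<chi> \<zero> = 1"
  using character_on_add[of G "carrier G" \<chi> \<zero> \<zero>] character_on_nonzero[of G "carrier G" \<chi> \<zero>]
  by (auto dest: add_charsD)

lemma a_subgroupD:
  assumes "additive_subgroup H G"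
  shows "H \<subseteq> carrier G" "\<zero> \<in> H" "\<And>x y. x \<in> H \<Longrightarrow> y \<in> H \<Longrightarrow> x \<oplus> y \<in> H"
    "\<And>x. x \<in> H \<Longrightarrow> \<ominus> x \<in> H"
  using assms subgroup.m_inv_closed[OF additive_subgroup.a_subgroup[OF assms]]
  by (simp_all add: additive_subgroup.a_subset additive_subgroup.zero_closed
      additive_subgroup.a_closed a_inv_def)

lemma a_subgroupI:
  assumes "H \<subseteq> carrier G" "\<zero> \<in> H" "\<And>x y. x \<in> H \<Longrightarrow> y \<in> H \<Longrightarrow> x \<oplus> y \<in> H"
    "\<And>x. x \<in> H \<Longrightarrow> \<ominus> x \<in> H"
  shows "additive_subgroup H G"
  using assms by (intro additive_subgroup.intro add.subgroupI) (auto simp: a_inv_def)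

lemma a_subgroup_add_pow:
  assumes "additive_subgroup H G" "x \<in> H"
  shows "[(i::int)] \<cdot> x \<in> H"
  using add.subgroup_int_pow_closed[OF additive_subgroup.a_subgroup[OF assms(1)] assms(2)] .

lemma character_on_zero:
  assumes "additive_subgroup H G" "character_on G H \<chi>"
  shows "\<chi> \<zero> = 1"
  using character_on_add[of G H \<chi> \<zero> \<zero>] character_on_nonzero[of G H \<chi> \<zero>] assms(2)
    a_subgroupD[OF assms(1)] by simp

lemma character_on_minus:
  assumes "additive_subgroup H G" "character_on G H \<chi>" "x \<in> H"
  shows "\<chi> (\<ominus> x) = inverse (\<chi> x)"
proof -
  have "\<chi> (\<ominus> x) * \<chi> x = 1"
    using character_on_add[of G H \<chi> "\<ominus> x" x] character_on_zero[of H \<chi>] assms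
      a_subgroupD[OF assms(1)] by (metis l_neg subsetD)
  then show ?thesis
    by (metis inverse_unique mult.commute)
qed

lemma character_on_add_pow:
  assumes "additive_subgroup H G" "character_on G H \<chi>" "x \<in> H"
  shows "\<chi> ([(i::int)] \<cdot> x) = \<chi> x powi i"
proof -
  have x: "x \<in> carrier G"
    using a_subgroupD(1)[OF assms(1)] assms(3) by blast
  have nz: "\<chi> x \<noteq> 0"
    using character_on_nonzero assms by metis
  have nat: "\<chi> ([(int n)] \<cdot> x) = \<chi> x powi int n" for n
  proof (induction n)
    case 0
    show ?case using x character_on_zero[OF assms(1,2)] by (simp add: add_pow_def)
  next
    case (Suc n)
    have "[(int (Suc n))] \<cdot> x = [(int n)] \<cdot> x \<oplus> x"
      using x add.int_pow_mult[of x "int n" 1] add.int_pow_1[of x] by (simp add: add.commute)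
    then show ?case
      using Suc character_on_add[OF assms(2) a_subgroup_add_pow[OF assms(1,3)] assms(3)] nz
      by (simp add: power_int_add)
  qed
  show ?thesis
  proof (cases "0 \<le> i")
    case True
    then show ?thesis using nat[of "nat i"] by simp
  next
    case False
    have "[i] \<cdot> x = \<ominus> ([(int (nat (-i)))] \<cdot> x)"
      using add.int_pow_neg[OF x, of "- i"] False by (simp add: a_inv_def)
    then show ?thesis
      using character_on_minus[OF assms(1,2) a_subgroup_add_pow[OF assms(1,3)]]
        nat[of "nat (-i)"] False by (simp add: power_int_minus)
  qed
qed

text \<open>The extension lives on H + Zx. The integers i with i x in H are the multiples of k, so
  the only constraint on the value at x is the one imposed by k x. The value c is left to the
  caller: extending needs some root, separating points needs one different from 1.\<close>

lemma character_extend_step: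
  fixes k :: int
  assumes H: "additive_subgroup H G" and \<chi>: "character_on G H \<chi>" and x: "x \<in> carrier G"
    and k: "\<And>i::int. [i] \<cdot> x \<in> H \<longleftrightarrow> k dvd i" and c: "c \<noteq> 0" "c powi k = \<chi> ([k] \<cdot> x)"
  obtains H' \<psi> where "additive_subgroup H' G" "H \<subseteq> H'" "x \<in> H'" "character_on G H' \<psi>"
    "\<And>h. h \<in> H \<Longrightarrow> \<psi> h = \<chi> h" "\<psi> x = c"
proof -
  note HD = a_subgroupD[OF H]
  have Hc: "h \<in> H \<Longrightarrow> h \<in> carrier G" for h using HD by blast
  define H' where "H' = {y. \<exists>h\<in>H. \<exists>i::int. y = h \<oplus> [i] \<cdot> x}"
  define \<psi> where "\<psi> y = (SOME z. \<exists>h\<in>H. \<exists>i::int. y = h \<oplus> [i] \<cdot> x \<and> z = \<chi> h * c powi i)" for y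
  \<comment> \<open>Two representations of one element differ by (i - j) x = h' - h in H. Then k
    divides i - j, and the constraint on c makes the two candidate values equal, so the choice in
    \<open>\<psi>\<close> is harmless.\<close>
  have uniq: "\<chi> h * c powi i = \<chi> h' * c powi j"
    if h: "h \<in> H" "h' \<in> H" and eq: "h \<oplus> [i] \<cdot> x = h' \<oplus> [j] \<cdot> x" for h h' and i j :: int
  proof -
    have ij: "[i] \<cdot> x = [(i - j)] \<cdot> x \<oplus> [j] \<cdot> x"
      using add.int_pow_mult[OF x, of "i - j" j] by simp
    have "(h \<oplus> [(i - j)] \<cdot> x) \<oplus> [j] \<cdot> x = h' \<oplus> [j] \<cdot> x"
      using eq ij h Hc x by (simp add: a_assoc)
    then have h': "h' = h \<oplus> [(i - j)] \<cdot> x"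
      using h Hc x by (metis add.int_pow_closed add.m_closed add.right_cancel)
    then have "[(i - j)] \<cdot> x = \<ominus> h \<oplus> h'"
      using h Hc x by (simp add: r_neg1)
    then have "[(i - j)] \<cdot> x \<in> H"
      using HD h by simp
    then obtain m where m: "i - j = k * m"
      using k by (auto elim: dvdE)
    have kH: "[k] \<cdot> x \<in> H" using k by simp
    have "[(i - j)] \<cdot> x = [m] \<cdot> ([k] \<cdot> x)"
      using add.int_pow_pow[OF x, of m k] m by (simp add: mult.commute)
    then have "\<chi> ([(i - j)] \<cdot> x) = c powi (i - j)"
      using character_on_add_pow[OF H \<chi> kH, of m] c m by (simp add: power_int_mult)
    then have "\<chi> h' = \<chi> h * c powi (i - j)"
      using h' character_on_add[OF \<chi> h(1) \<open>[(i - j)] \<cdot> x \<in> H\<close>] by simp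
    then show ?thesis
      using c(1) by (simp add: power_int_diff)
  qed
  have \<psi>: "\<psi> (h \<oplus> [i] \<cdot> x) = \<chi> h * c powi i" if "h \<in> H" for h and i :: int
    unfolding \<psi>_def
  proof (rule some_equality)
    show "\<exists>h'\<in>H. \<exists>j::int. h \<oplus> [i] \<cdot> x = h' \<oplus> [j] \<cdot> x \<and> \<chi> h * c powi i = \<chi> h' * c powi j"
      using that by blast
  qed (use uniq[OF that] in metis)
  have sum: "(h \<oplus> [i] \<cdot> x) \<oplus> (h' \<oplus> [j] \<cdot> x) = (h \<oplus> h') \<oplus> [(i + j)] \<cdot> x"
    if "h \<in> H" "h' \<in> H" for h h' and i j :: int
    using that Hc x add.int_pow_mult[OF x, of i j] by (simp add: a_ac)
  have neg: "\<ominus> (h \<oplus> [i] \<cdot> x) = (\<ominus> h) \<oplus> [(- i)] \<cdot> x" if "h \<in> H" for h and i :: int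
  proof -
    have "[(- i)] \<cdot> x = \<ominus> ([i] \<cdot> x)"
      using add.int_pow_neg[OF x, of i] by (simp add: a_inv_def)
    then show ?thesis
      using that Hc x by (simp add: minus_add)
  qed
  have z: "[(0::int)] \<cdot> x = \<zero>" by (simp add: add_pow_def)
  show ?thesis
  proof (rule that[of H' \<psi>])
    show "additive_subgroup H' G"
    proof (rule a_subgroupI)
      show "H' \<subseteq> carrier G" using Hc x by (auto simp: H'_def)
      show "\<zero> \<in> H'" unfolding H'_def using HD(2) z
        by (auto intro!: bexI[of _ "\<zero>"] exI[of _ "0::int"])
      show "y \<oplus> y' \<in> H'" if "y \<in> H'" "y' \<in> H'" for y y'
        using that sum HD(3) unfolding H'_def by blast
      show "\<ominus> y \<in> H'" if "y \<in> H'" for y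
        using that neg HD(4) unfolding H'_def by blast
    qed
    show HH': "H \<subseteq> H'"
    proof
      fix h assume "h \<in> H"
      then show "h \<in> H'" unfolding H'_def using Hc z
        by (auto intro!: bexI[of _ h] exI[of _ "0::int"])
    qed
    show "x \<in> H'" unfolding H'_def using x add.int_pow_1[OF x] HD(2)
      by (auto intro!: bexI[of _ "\<zero>"] exI[of _ "1::int"])
    show "character_on G H' \<psi>"
    proof (rule character_onI)
      show "\<psi> y \<noteq> 0" if "y \<in> H'" for y
        using that \<psi> c(1) character_on_nonzero[OF \<chi>] by (auto simp: H'_def)
      show "\<psi> (y \<oplus> y') = \<psi> y * \<psi> y'" if yy: "y \<in> H'" "y' \<in> H'" for y y'
      proof -
        obtain h h' i j where *: "h \<in> H" "h' \<in> H" "y = h \<oplus> [(i::int)] \<cdot> x" "y' = h' \<oplus> [(j::int)] \<cdot> x"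
          using yy unfolding H'_def by blast
        show ?thesis
          using sum[OF *(1,2), of i j] \<psi>[OF HD(3)[OF *(1,2)], of "i + j"] \<psi> *
            character_on_add[OF \<chi> *(1,2)] c(1)
          by (simp add: power_int_add)
      qed
    qed
    show "\<psi> h = \<chi> h" if "h \<in> H" for h
      using \<psi>[OF that, of 0] z Hc[OF that] by simp
    show "\<psi> x = c"
      using \<psi>[OF HD(2), of 1] x add.int_pow_1[OF x] character_on_zero[OF H \<chi>] by simp
  qed
qed

text \<open>These i form an ideal of the integers. It is nonzero because x has finite order, and its
  least positive element k generates it by division with remainder.\<close>

lemma multiples_in_subgroup:
  assumes "finite (carrier G)" "additive_subgroup H G" "x \<in> carrier G"
  obtains k :: nat where "k > 0" "\<And>i::int. [i] \<cdot> x \<in> H \<longleftrightarrow> int k dvd i"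
proof -
  note HD = a_subgroupD[OF assms(2)]
  have "[(int (add.ord x))] \<cdot> x = \<zero>"
    using add.int_pow_eq_id[OF assms(3)] by simp
  moreover have "add.ord x > 0"
    using assms(1,3) add.ord_ge_1 by fastforce
  ultimately have ex: "\<exists>k>0. [(int k)] \<cdot> x \<in> H"
    using HD(2) by metis
  define k where "k = (LEAST k. k > 0 \<and> [(int k)] \<cdot> x \<in> H)"
  have k: "k > 0" "[(int k)] \<cdot> x \<in> H"
    using LeastI_ex[OF ex] unfolding k_def by auto
  have "[i] \<cdot> x \<in> H \<longleftrightarrow> int k dvd i" for i :: int
  proof
    assume "int k dvd i"
    then obtain m where "i = int k * m" by (elim dvdE)
    then have "[i] \<cdot> x = [m] \<cdot> ([(int k)] \<cdot> x)"
      using add.int_pow_pow[OF assms(3), of m "int k"] by (simp add: mult.commute)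
    then show "[i] \<cdot> x \<in> H"
      using a_subgroup_add_pow[OF assms(2) k(2)] by simp
  next
    assume i: "[i] \<cdot> x \<in> H"
    define r where "r = nat (i mod int k)"
    have r: "int r = i - int k * (i div int k)"
      using k(1) by (simp add: r_def minus_mult_div_eq_mod)
    have "[(int r)] \<cdot> x = [i] \<cdot> x \<oplus> [(- (i div int k))] \<cdot> ([(int k)] \<cdot> x)"
      using add.int_pow_pow[OF assms(3), of "- (i div int k)" "int k"]
        add.int_pow_mult[OF assms(3), of i "int k * - (i div int k)"] r
      by (simp add: mult.commute)
    then have "[(int r)] \<cdot> x \<in> H"
      using i HD(3) a_subgroup_add_pow[OF assms(2) k(2)] by simp
    moreover have "r < k"
      using k(1) by (simp add: r_def nat_less_iff)
    ultimately have "r = 0"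
      using not_less_Least[of r "\<lambda>k. k > 0 \<and> [(int k)] \<cdot> x \<in> H"] unfolding k_def by auto
    then show "int k dvd i"
      using r by (simp add: dvd_def) (metis)
  qed
  then show ?thesis
    using k(1) that by blast
qed

text \<open>One element is adjoined at a time, by induction on the number of elements still missing;
  a k-th root of the prescribed value at k x always exists.\<close>

lemma character_extend:
  assumes "finite (carrier G)" "additive_subgroup H G" "character_on G H \<chi>"
  obtains \<psi> where "\<psi> \<in> add_chars G" "\<And>h. h \<in> H \<Longrightarrow> \<psi> h = \<chi> h"
proof -
  have "\<exists>\<psi>\<in>add_chars G. \<forall>h\<in>H. \<psi> h = \<chi> h"
    using assms(2,3)
  proof (induction "card (carrier G - H)" arbitrary: H \<chi> rule: less_induct)
    case less
    note HD = a_subgroupD[OF less.prems(1)]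
    show ?case
    proof (cases "H = carrier G")
      case True
      then show ?thesis
        using restrict_in_add_chars less.prems(2) by (intro bexI[of _ "restrict \<chi> (carrier G)"]) auto
    next
      case False
      then obtain x where x: "x \<in> carrier G" "x \<notin> H" using HD(1) by blast
      obtain k :: nat where k: "k > 0" "\<And>i::int. [i] \<cdot> x \<in> H \<longleftrightarrow> int k dvd i"
        using multiples_in_subgroup[OF assms(1) less.prems(1) x(1)] by blast
      have nz: "\<chi> ([(int k)] \<cdot> x) \<noteq> 0"
        using character_on_nonzero[OF less.prems(2)] k by simp
      obtain c where c: "c ^ k = \<chi> ([(int k)] \<cdot> x)"
        using complex_nth_root_exists[OF nz k(1)] by blast
      have c0: "c \<noteq> 0" using c nz k(1) by (metis power_0_left not_gr_zero)
      have ck: "c powi int k = \<chi> ([(int k)] \<cdot> x)" using c by simp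
      obtain H' \<psi> where *: "additive_subgroup H' G" "H \<subseteq> H'" "x \<in> H'" "character_on G H' \<psi>"
        "\<And>h. h \<in> H \<Longrightarrow> \<psi> h = \<chi> h"
        using character_extend_step[OF less.prems x(1) k(2) c0 ck] by metis
      have "card (carrier G - H') < card (carrier G - H)"
        using * x assms(1) by (intro psubset_card_mono) auto
      from less.hyps[OF this *(1,4)] show ?thesis
        using * by (metis subsetD)
    qed
  qed
  then show ?thesis using that by blast
qed

text \<open>Over the zero subgroup k is the order of x, hence at least 2. So the primitive root
  \<open>cis (2 * pi / real k)\<close> is an admissible value at x and differs from 1.\<close>

lemma character_separates:
  assumes "finite (carrier G)" "x \<in> carrier G" "x \<noteq> \<zero>"
  obtains \<chi> where "\<chi> \<in> add_chars G" "\<chi> x \<noteq> 1"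
proof -
  have H: "additive_subgroup {\<zero>} G"
    by (rule a_subgroupI) auto
  have one: "character_on G {\<zero>} (\<lambda>_. 1)"
    by (simp add: character_on_def)
  obtain k :: nat where k: "k > 0" "\<And>i::int. [i] \<cdot> x \<in> {\<zero>} \<longleftrightarrow> int k dvd i"
    using multiples_in_subgroup[OF assms(1) H assms(2)] by blast
  have "k \<noteq> 1"
    using k(2)[of 1] add.int_pow_1[OF assms(2)] assms(3) by auto
  then have k2: "k > 1" using k(1) by simp
  define c where "c = cis (2 * pi / real k)"
  have c: "c powi int k = 1" "c \<noteq> 0"
    using k(1) DeMoivre[of "2 * pi / real k" k] by (simp_all add: c_def)
  have "c \<noteq> 1"
  proof
    assume "c = 1"
    have "inj_on (\<lambda>j. cis (2 * pi * real j / real k)) {..<k}"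
      using bij_betw_roots_unity[OF k(1)] by (simp add: bij_betw_def)
    from inj_onD[OF this, of 0 1] show False
      using k2 \<open>c = 1\<close> by (simp add: c_def)
  qed
  obtain H' \<psi> where *: "additive_subgroup H' G" "x \<in> H'" "character_on G H' \<psi>" "\<psi> x = c"
    using character_extend_step[OF H one assms(2) k(2) c(2,1)] by metis
  obtain \<chi> where "\<chi> \<in> add_chars G" "\<And>h. h \<in> H' \<Longrightarrow> \<chi> h = \<psi> h"
    using character_extend[OF assms(1) *(1,3)] by blast
  then show ?thesis
    using that[of \<chi>] * \<open>c \<noteq> 1\<close> by simp
qed

lemma add_char_pow_eq_1:
  assumes "\<chi> \<in> add_chars G" "x \<in> carrier G" "[(int m)] \<cdot> x = \<zero>"
  shows "\<chi> x ^ m = 1"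
  using character_on_add_pow[of "carrier G" \<chi> x "int m"] add_char_zero[OF assms(1)]
    add_charsD[OF assms(1)] assms by (simp add: a_subgroupI)

section \<open>Orthogonality and the size of annihilators\<close>

lemma finite_add_chars:
  assumes "finite (carrier G)"
  shows "finite (add_chars G)"
proof -
  define m where "m = order (add_monoid G)"
  have m: "m > 0"
    using assms add.order_gt_0_iff_finite by (simp add: m_def)
  have "add_chars G \<subseteq> (\<Pi>\<^sub>E x\<in>carrier G. {z. z ^ m = 1})"
  proof
    fix \<chi> assume \<chi>: "\<chi> \<in> add_chars G"
    have "\<chi> x ^ m = 1" if x: "x \<in> carrier G" for x
      using add_char_pow_eq_1[OF \<chi> x, of m] add.pow_order_eq_1[of x] x
      by (simp add: m_def add_pow_int_ge)
    then show "\<chi> \<in> (\<Pi>\<^sub>E x\<in>carrier G. {z. z ^ m = 1})"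
      using \<chi> by (auto simp: add_chars_def PiE_def)
  qed
  moreover have "finite (\<Pi>\<^sub>E x\<in>carrier G. {z::complex. z ^ m = 1})"
    using assms m by (intro finite_PiE) (auto intro!: card_ge_0_finite simp: card_roots_unity_eq)
  ultimately show ?thesis
    by (rule finite_subset)
qed

text \<open>Translation by an element a of T permutes T and multiplies the sum by
  \<open>\<chi> a\<close>; if this is not 1, the sum vanishes.\<close>

lemma sum_character:
  assumes "finite T" "additive_subgroup T G" "character_on G T \<chi>"
  shows "sum \<chi> T = (if \<forall>t\<in>T. \<chi> t = 1 then of_nat (card T) else 0)"
proof (cases "\<forall>t\<in>T. \<chi> t = 1")
  case True
  then show ?thesis by simp
next
  case False
  note TD = a_subgroupD[OF assms(2)]
  obtain a where a: "a \<in> T" "\<chi> a \<noteq> 1" using False by blast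
  have "bij_betw (\<lambda>t. a \<oplus> t) T T"
    by (rule bij_betw_byWitness[of _ "\<lambda>t. \<ominus> a \<oplus> t"])
      (use TD a in \<open>auto simp: r_neg1 r_neg2 subset_iff\<close>)
  then have "sum \<chi> T = (\<Sum>t\<in>T. \<chi> (a \<oplus> t))"
    using sum.reindex_bij_betw[of "\<lambda>t. a \<oplus> t" T T \<chi>] by simp
  also have "\<dots> = \<chi> a * sum \<chi> T"
    using character_on_add[OF assms(3) a(1)] by (simp add: sum_distrib_left)
  finally have "sum \<chi> T = 0"
    using a by simp
  with False show ?thesis
    by (simp only: if_False)
qed

text \<open>The dual argument: multiplication by a character \<open>\<psi>\<close> with
  \<open>\<psi> x \<noteq> 1\<close> permutes all characters and scales the sum by
  \<open>\<psi> x\<close>.\<close>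

lemma sum_over_add_chars:
  assumes "finite (carrier G)" "x \<in> carrier G"
  shows "(\<Sum>\<chi>\<in>add_chars G. \<chi> x) = (if x = \<zero> then of_nat (card (add_chars G)) else 0)"
proof (cases "x = \<zero>")
  case True
  then show ?thesis by (simp add: add_char_zero)
next
  case False
  obtain \<psi> where \<psi>: "\<psi> \<in> add_chars G" "\<psi> x \<noteq> 1"
    using character_separates[OF assms False] .
  let ?f = "\<lambda>\<chi>. \<lambda>y\<in>carrier G. \<psi> y * \<chi> y"
  let ?g = "\<lambda>\<chi>. \<lambda>y\<in>carrier G. inverse (\<psi> y) * \<chi> y"
  have nz: "\<psi> y \<noteq> 0" if "y \<in> carrier G" for y
    using that \<psi>(1) by (auto simp: add_chars_def character_on_def)
  have "bij_betw ?f (add_chars G) (add_chars G)"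
  proof (rule bij_betw_byWitness[of _ ?g])
    show "\<forall>\<chi>\<in>add_chars G. ?g (?f \<chi>) = \<chi>" "\<forall>\<chi>\<in>add_chars G. ?f (?g \<chi>) = \<chi>"
      using nz by (auto simp: add_chars_def extensional_def fun_eq_iff)
    show "?f ` add_chars G \<subseteq> add_chars G" "?g ` add_chars G \<subseteq> add_chars G"
      using \<psi>(1) by (auto simp: add_chars_def character_on_def)
  qed
  then have "(\<Sum>\<chi>\<in>add_chars G. \<chi> x) = (\<Sum>\<chi>\<in>add_chars G. ?f \<chi> x)"
    by (rule sum.reindex_bij_betw[symmetric])
  also have "\<dots> = \<psi> x * (\<Sum>\<chi>\<in>add_chars G. \<chi> x)"
    using assms(2) by (simp add: sum_distrib_left)
  finally show ?thesis
    using \<psi> False by simp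
qed

text \<open>The double sum of \<open>\<chi> t\<close> over all characters and all t in T is
  evaluated in both orders, once by each orthogonality relation.\<close>

lemma card_annihilator_aux:
  assumes "finite (carrier G)" "additive_subgroup T G"
  shows "card T * card {\<chi> \<in> add_chars G. \<forall>t\<in>T. \<chi> t = 1} = card (add_chars G)"
proof -
  note TD = a_subgroupD[OF assms(2)]
  have fin: "finite T" using TD(1) assms(1) finite_subset by blast
  have "of_nat (card T * card {\<chi> \<in> add_chars G. \<forall>t\<in>T. \<chi> t = 1})
      = (\<Sum>\<chi>\<in>add_chars G. if \<forall>t\<in>T. \<chi> t = 1 then complex_of_nat (card T) else 0)"
    using finite_add_chars[OF assms(1)]
    by (simp add: sum.If_cases Int_def conj_commute mult.commute)
  also have "\<dots> = (\<Sum>\<chi>\<in>add_chars G. sum \<chi> T)"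
    by (intro sum.cong refl sum_character[symmetric] fin assms(2) character_on_subset[OF _ TD(1)] add_charsD)
  also have "\<dots> = (\<Sum>t\<in>T. \<Sum>\<chi>\<in>add_chars G. \<chi> t)"
    by (rule sum.swap)
  also have "\<dots> = (\<Sum>t\<in>T. if t = \<zero> then of_nat (card (add_chars G)) else 0)"
    by (intro sum.cong refl sum_over_add_chars assms(1)) (use TD in auto)
  also have "\<dots> = of_nat (card (add_chars G))"
    using TD(2) fin by simp
  finally show ?thesis
    by (simp only: of_nat_eq_iff)
qed

text \<open>Taking the whole group for T leaves only the trivial character in the
  annihilator.\<close>

lemma card_add_chars:
  assumes "finite (carrier G)"
  shows "card (add_chars G) = card (carrier G)"
proof -
  have "{\<chi> \<in> add_chars G. \<forall>t\<in>carrier G. \<chi> t = 1} = {\<lambda>t\<in>carrier G. 1}"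
    by (auto simp: add_chars_def character_on_def extensional_def fun_eq_iff)
  then show ?thesis
    using card_annihilator_aux[OF assms, of "carrier G"] by (simp add: a_subgroupI)
qed

lemma card_annihilator:
  assumes "finite (carrier G)" "additive_subgroup T G"
  shows "card T * card {\<chi> \<in> add_chars G. \<forall>t\<in>T. \<chi> t = 1} = card (carrier G)"
  using card_annihilator_aux[OF assms] card_add_chars[OF assms(1)] by simp

text \<open>Summing \<open>b x y\<close> over all pairs counts either kernel.\<close>

lemma card_pairing_kernels:
  fixes b :: "'a \<Rightarrow> 'a \<Rightarrow> complex"
  assumes "finite T" "additive_subgroup T G"
    and "\<And>x. x \<in> T \<Longrightarrow> character_on G T (b x)" "\<And>y. y \<in> T \<Longrightarrow> character_on G T (\<lambda>x. b x y)"
  shows "card {x \<in> T. \<forall>y\<in>T. b x y = 1} = card {y \<in> T. \<forall>x\<in>T. b x y = 1}"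
proof -
  have *: "(\<Sum>x\<in>T. \<Sum>y\<in>T. c x y) = of_nat (card T * card {x \<in> T. \<forall>y\<in>T. c x y = 1})"
    if "\<And>x. x \<in> T \<Longrightarrow> character_on G T (c x)" for c :: "'a \<Rightarrow> 'a \<Rightarrow> complex"
  proof -
    have "(\<Sum>x\<in>T. \<Sum>y\<in>T. c x y) = (\<Sum>x\<in>T. if \<forall>y\<in>T. c x y = 1 then of_nat (card T) else 0)"
      by (intro sum.cong refl sum_character assms(1,2) that)
    also have "\<dots> = of_nat (card T * card {x \<in> T. \<forall>y\<in>T. c x y = 1})"
      using assms(1) by (simp add: sum.If_cases Int_def conj_commute mult.commute)
    finally show ?thesis .
  qed
  have "complex_of_nat (card T * card {x \<in> T. \<forall>y\<in>T. b x y = 1})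
      = complex_of_nat (card T * card {y \<in> T. \<forall>x\<in>T. b x y = 1})"
    using *[of b, OF assms(3)] *[of "\<lambda>y x. b x y", OF assms(4)] sum.swap[of b T T]
    by (simp only:)
  then have "card T * card {x \<in> T. \<forall>y\<in>T. b x y = 1}
      = card T * card {y \<in> T. \<forall>x\<in>T. b x y = 1}"
    by (simp only: of_nat_eq_iff)
  moreover have "card T > 0"
    using a_subgroupD(2)[OF assms(2)] assms(1) card_gt_0_iff by blast
  ultimately show ?thesis by simp
qed

end

subsection \<open>Faithful characters of finite semiprime rings\<close>

context abelian_group
begin

text \<open>The sum A + B is direct, so a(p) b(q) is a well-defined character on it, which then
  extends to the whole group.\<close>

lemma character_glue:
  assumes fin: "finite (carrier G)" and A: "additive_subgroup A G" and B: "additive_subgroup B G"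
    and AB: "A \<inter> B = {\<zero>}" and a: "character_on G A a" and b: "character_on G B b"
  obtains \<chi> where "\<chi> \<in> add_chars G" "\<And>x. x \<in> A \<Longrightarrow> \<chi> x = a x" "\<And>x. x \<in> B \<Longrightarrow> \<chi> x = b x"
proof -
  note AD = a_subgroupD[OF A] and BD = a_subgroupD[OF B]
  have Ac: "x \<in> A \<Longrightarrow> x \<in> carrier G" and Bc: "x \<in> B \<Longrightarrow> x \<in> carrier G" for x
    using AD BD by auto
  define H where "H = {y. \<exists>p\<in>A. \<exists>q\<in>B. y = p \<oplus> q}"
  define \<psi> where "\<psi> y = (SOME z. \<exists>p\<in>A. \<exists>q\<in>B. y = p \<oplus> q \<and> z = a p * b q)" for y
  \<comment> \<open>The difference p - p' = q' - q lies in both subgroups, hence is zero.\<close>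
  have uniq: "p = p' \<and> q = q'"
    if "p \<in> A" "p' \<in> A" "q \<in> B" "q' \<in> B" "p \<oplus> q = p' \<oplus> q'" for p p' q q'
  proof -
    have c: "p \<in> carrier G" "p' \<in> carrier G" "q \<in> carrier G" "q' \<in> carrier G"
      using that Ac Bc by auto
    have "\<ominus> p' \<oplus> (p \<oplus> q) \<oplus> \<ominus> q = \<ominus> p' \<oplus> p"
      "\<ominus> p' \<oplus> (p' \<oplus> q') \<oplus> \<ominus> q = q' \<oplus> \<ominus> q"
      using c by (simp_all add: a_assoc r_neg r_neg1)
    then have "\<ominus> p' \<oplus> p = q' \<oplus> \<ominus> q"
      using that(5) by simp
    moreover have "\<ominus> p' \<oplus> p \<in> A" "q' \<oplus> \<ominus> q \<in> B"
      using that AD BD by auto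
    ultimately have 0: "\<ominus> p' \<oplus> p = \<zero>" "q' \<oplus> \<ominus> q = \<zero>"
      using AB by auto
    have "p = p' \<oplus> (\<ominus> p' \<oplus> p)" "q' = q' \<oplus> \<ominus> q \<oplus> q"
      using c by (simp_all add: r_neg2 a_assoc l_neg)
    then show ?thesis
      using 0 c by simp
  qed
  have \<psi>: "\<psi> (p \<oplus> q) = a p * b q" if "p \<in> A" "q \<in> B" for p q
    unfolding \<psi>_def
  proof (rule some_equality)
    show "\<exists>p'\<in>A. \<exists>q'\<in>B. p \<oplus> q = p' \<oplus> q' \<and> a p * b q = a p' * b q'"
      using that by blast
  qed (use uniq that in metis)
  have sum: "(p \<oplus> q) \<oplus> (p' \<oplus> q') = (p \<oplus> p') \<oplus> (q \<oplus> q')"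
    if "p \<in> A" "p' \<in> A" "q \<in> B" "q' \<in> B" for p p' q q'
    using that Ac Bc by (simp add: a_ac)
  have H: "additive_subgroup H G"
  proof (rule a_subgroupI)
    show "H \<subseteq> carrier G" using Ac Bc by (auto simp: H_def)
    show "\<zero> \<in> H" unfolding H_def using AD(2) BD(2)
      by (auto intro!: bexI[of _ "\<zero>"])
    show "y \<oplus> y' \<in> H" if "y \<in> H" "y' \<in> H" for y y'
      using that sum AD(3) BD(3) unfolding H_def by blast
    show "\<ominus> y \<in> H" if "y \<in> H" for y
      using that AD(4) BD(4) Ac Bc minus_add unfolding H_def by blast
  qed
  have "character_on G H \<psi>"
  proof (rule character_onI)
    show "\<psi> y \<noteq> 0" if "y \<in> H" for y
      using that \<psi> character_on_nonzero[OF a] character_on_nonzero[OF b] by (auto simp: H_def)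
    show "\<psi> (y \<oplus> y') = \<psi> y * \<psi> y'" if yy: "y \<in> H" "y' \<in> H" for y y'
    proof -
      obtain p q p' q' where *: "p \<in> A" "p' \<in> A" "q \<in> B" "q' \<in> B" "y = p \<oplus> q" "y' = p' \<oplus> q'"
        using yy unfolding H_def by blast
      show ?thesis
        using sum[OF *(1-4)] \<psi>[OF AD(3)[OF *(1,2)] BD(3)[OF *(3,4)]] \<psi> *
          character_on_add[OF a *(1,2)] character_on_add[OF b *(3,4)]
        by simp
    qed
  qed
  then obtain \<chi> where \<chi>: "\<chi> \<in> add_chars G" "\<And>h. h \<in> H \<Longrightarrow> \<chi> h = \<psi> h"
    using character_extend[OF fin H] by metis
  have "\<chi> x = a x" if "x \<in> A" for x
  proof -
    have "x = x \<oplus> \<zero>" using that Ac by simp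
    moreover have "x \<oplus> \<zero> \<in> H" using that BD(2) by (auto simp only: H_def)
    ultimately show ?thesis
      using \<chi>(2) \<psi>[OF that BD(2)] character_on_zero[OF B b] by simp
  qed
  moreover have "\<chi> x = b x" if "x \<in> B" for x
  proof -
    have "x = \<zero> \<oplus> x" using that Bc by simp
    moreover have "\<zero> \<oplus> x \<in> H" using that AD(2) by (auto simp only: H_def)
    ultimately show ?thesis
      using \<chi>(2) \<psi>[OF AD(2) that] character_on_zero[OF A a] by simp
  qed
  ultimately show ?thesis
    using that \<chi>(1) by blast
qed

end

section \<open>Passage to the opposite ring\<close>

lemma opp_ring_simps [simp]:
  "carrier (opp_ring R) = carrier R"
  "monoid.mult (opp_ring R) x y = y \<otimes>\<^bsub>R\<^esub> x"
  "one (opp_ring R) = one R"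
  "ring.zero (opp_ring R) = ring.zero R"
  "add (opp_ring R) = add R"
  by (simp_all add: opp_ring_def)

lemma add_chars_opp_ring [simp]: "add_chars (opp_ring R) = add_chars R"
  by (simp add: add_chars_def character_on_def)

lemma ring_opp_ring:
  assumes "ring R"
  shows "ring (opp_ring R)"
proof -
  interpret ring R by fact
  show ?thesis
    by (rule ringI)
      (auto intro!: abelian_groupI monoidI simp: a_assoc m_assoc a_lcomm a_comm l_distr r_distr
        intro: add.l_inv_ex)
qed

lemma a_inv_opp_ring:
  assumes "ring R" "x \<in> carrier R"
  shows "\<ominus>\<^bsub>opp_ring R\<^esub> x = \<ominus>\<^bsub>R\<^esub> x"
proof -
  interpret R: ring R by fact
  interpret O: ring "opp_ring R" by (rule ring_opp_ring) fact
  show ?thesis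
    using O.minus_equality[of "\<ominus>\<^bsub>R\<^esub> x" x] assms(2) R.l_neg by simp
qed

lemma ideal_opp_ring:
  assumes "ideal I R"
  shows "ideal I (opp_ring R)"
proof -
  interpret I: ideal I R by fact
  interpret O: ring "opp_ring R" by (rule ring_opp_ring) (rule I.ring_axioms)
  note ID = I.a_subgroupD[OF I.additive_subgroup_axioms]
  have "additive_subgroup I (opp_ring R)"
    by (rule O.a_subgroupI) (use ID in \<open>auto simp: a_inv_opp_ring[OF I.ring_axioms]\<close>)
  then show ?thesis
    by (intro idealI additive_subgroup.a_subgroup O.ring_axioms) (auto simp: I.I_l_closed I.I_r_closed)
qed

text \<open>
  The analogue for right multiples is faithfulness over the opposite ring.
\<close>

definition faithful_on :: "('a, 'm) ring_scheme \<Rightarrow> 'a set \<Rightarrow> ('a \<Rightarrow> complex) \<Rightarrow> bool" where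
  "faithful_on R I \<chi> \<longleftrightarrow>
     (\<forall>x\<in>I. (\<forall>r\<in>carrier R. \<chi> (r \<otimes>\<^bsub>R\<^esub> x) = 1) \<longrightarrow> x = \<zero>\<^bsub>R\<^esub>)"

lemma faithful_onD:
  "\<lbrakk>faithful_on R I \<chi>; x \<in> I; \<And>r. r \<in> carrier R \<Longrightarrow> \<chi> (r \<otimes>\<^bsub>R\<^esub> x) = 1\<rbrakk> \<Longrightarrow> x = \<zero>\<^bsub>R\<^esub>"
  by (simp add: faithful_on_def)

text \<open>The elementwise form of having no nonzero nilpotent ideal. The condition x R x = 0 is
  symmetric, so it passes to the opposite ring at once.\<close>

definition semiprime_ring :: "('a, 'm) ring_scheme \<Rightarrow> bool" where
  "semiprime_ring R \<longleftrightarrow>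
     (\<forall>x\<in>carrier R. (\<forall>r\<in>carrier R. x \<otimes>\<^bsub>R\<^esub> r \<otimes>\<^bsub>R\<^esub> x = \<zero>\<^bsub>R\<^esub>) \<longrightarrow> x = \<zero>\<^bsub>R\<^esub>)"

lemma semiprime_opp_ring: "ring R \<Longrightarrow> semiprime_ring R \<Longrightarrow> semiprime_ring (opp_ring R)"
  by (simp add: semiprime_ring_def ring.ring_simprules(11))

context ring
begin

lemma add_charsD_ring:
  assumes "\<chi> \<in> add_chars R"
  shows "\<And>x. x \<in> carrier R \<Longrightarrow> \<chi> x \<noteq> 0"
    "\<And>x y. x \<in> carrier R \<Longrightarrow> y \<in> carrier R \<Longrightarrow> \<chi> (x \<oplus> y) = \<chi> x * \<chi> y"
  using assms by (auto simp: add_chars_def character_on_def)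

lemma character_on_mult:
  assumes "\<chi> \<in> add_chars R" "x \<in> carrier R" "P \<subseteq> carrier R"
  shows "character_on R P (\<lambda>y. \<chi> (x \<otimes> y))" "character_on R P (\<lambda>y. \<chi> (y \<otimes> x))"
  using assms by (auto simp: character_on_def r_distr l_distr subset_iff add_charsD_ring)

text \<open>The pairing \<open>\<chi> (x \<otimes> y)\<close> on P has kernels of equal size on both
  sides. Faithfulness tests against all of R and the pairing only against P; \<open>nz\<close>
  bridges the gap, since for y in the right kernel the character is trivial on R p y for each p in
  P, whence P y = 0.\<close>

lemma faithful_on_opp_ring:
  assumes fin: "finite (carrier R)" and P: "ideal P R" and \<chi>: "\<chi> \<in> add_chars R"
    and f: "faithful_on R P \<chi>"
    and nz: "\<And>y. y \<in> P \<Longrightarrow> (\<And>p. p \<in> P \<Longrightarrow> p \<otimes> y = \<zero>) \<Longrightarrow> y = \<zero>"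
  shows "faithful_on (opp_ring R) P \<chi>"
proof -
  interpret P: ideal P R by fact
  have Pc: "P \<subseteq> carrier R" by (rule P.a_subset)
  have finP: "finite P" using finite_subset[OF Pc fin] .
  have "{y \<in> P. \<forall>x\<in>P. \<chi> (x \<otimes> y) = 1} = {\<zero>}"
  proof (intro equalityI subsetI)
    fix y assume "y \<in> {y \<in> P. \<forall>x\<in>P. \<chi> (x \<otimes> y) = 1}"
    then have y: "y \<in> P" "\<And>x. x \<in> P \<Longrightarrow> \<chi> (x \<otimes> y) = 1" by auto
    have "p \<otimes> y = \<zero>" if p: "p \<in> P" for p
    proof (rule faithful_onD[OF f])
      show "p \<otimes> y \<in> P" using p y(1) Pc P.I_l_closed by blast
      show "\<chi> (r \<otimes> (p \<otimes> y)) = 1" if "r \<in> carrier R" for r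
        using y(2)[of "r \<otimes> p"] p y(1) Pc that P.I_l_closed by (auto simp: m_assoc subset_iff)
    qed
    then show "y \<in> {\<zero>}" using nz[OF y(1)] by simp
  next
    fix y assume "y \<in> {\<zero>}"
    then show "y \<in> {y \<in> P. \<forall>x\<in>P. \<chi> (x \<otimes> y) = 1}"
      using Pc add_char_zero[OF \<chi>] P.zero_closed by (auto simp: subset_iff)
  qed
  moreover have "card {x \<in> P. \<forall>y\<in>P. \<chi> (x \<otimes> y) = 1} = card {y \<in> P. \<forall>x\<in>P. \<chi> (x \<otimes> y) = 1}"
    by (rule card_pairing_kernels[OF finP P.additive_subgroup_axioms])
      (use character_on_mult[OF \<chi>] Pc in auto)
  ultimately have "card {x \<in> P. \<forall>y\<in>P. \<chi> (x \<otimes> y) = 1} = 1" by simp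
  then obtain z where z: "{x \<in> P. \<forall>y\<in>P. \<chi> (x \<otimes> y) = 1} = {z}"
    by (auto simp: card_1_singleton_iff)
  have z0: "\<zero> \<in> {x \<in> P. \<forall>y\<in>P. \<chi> (x \<otimes> y) = 1}"
    using Pc add_char_zero[OF \<chi>] P.zero_closed by (auto simp: subset_iff)
  show ?thesis
    unfolding faithful_on_def
  proof (intro ballI impI)
    fix x assume x: "x \<in> P" "\<forall>r\<in>carrier (opp_ring R). \<chi> (r \<otimes>\<^bsub>opp_ring R\<^esub> x) = 1"
    then have "x \<in> {x \<in> P. \<forall>y\<in>P. \<chi> (x \<otimes> y) = 1}" using Pc by auto
    then show "x = \<zero>\<^bsub>opp_ring R\<^esub>" using z z0 by simp
  qed
qed

lemma faithful_opp_ring: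
  assumes "finite (carrier R)" "\<chi> \<in> add_chars R" "faithful_on R (carrier R) \<chi>"
  shows "faithful_on (opp_ring R) (carrier R) \<chi>"
  using faithful_on_opp_ring[OF assms(1) oneideal assms(2,3)] by (metis l_one one_closed)

lemma semiprimeD:
  "\<lbrakk>semiprime_ring R; x \<in> carrier R; \<And>r. r \<in> carrier R \<Longrightarrow> x \<otimes> r \<otimes> x = \<zero>\<rbrakk> \<Longrightarrow> x = \<zero>"
  by (simp add: semiprime_ring_def)

text \<open>With y also every y r lies in P, so y R y = 0.\<close>

lemma semiprime_ideal_annihilator:
  assumes "semiprime_ring R" "ideal P R" "y \<in> P" "\<And>p. p \<in> P \<Longrightarrow> p \<otimes> y = \<zero>"
  shows "y = \<zero>"
proof -
  interpret P: ideal P R by fact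
  show ?thesis
    by (rule semiprimeD[OF assms(1) P.Icarr[OF assms(3)] assms(4)[OF P.I_r_closed[OF assms(3)]]])
qed

lemma left_multiples_subgroup:
  assumes "x \<in> carrier R"
  shows "additive_subgroup ((\<lambda>r. r \<otimes> x) ` carrier R) R"
proof (rule a_subgroupI)
  show "\<zero> \<in> (\<lambda>r. r \<otimes> x) ` carrier R"
    using assms by (auto intro!: image_eqI[of _ _ "\<zero>"])
  fix a assume "a \<in> (\<lambda>r. r \<otimes> x) ` carrier R"
  then obtain r where r: "a = r \<otimes> x" "r \<in> carrier R" ..
  show "\<ominus> a \<in> (\<lambda>r. r \<otimes> x) ` carrier R"
    by (rule image_eqI[of _ _ "\<ominus> r"]) (use assms r in \<open>simp_all add: l_minus\<close>)
  fix b assume "b \<in> (\<lambda>r. r \<otimes> x) ` carrier R"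
  then obtain s where s: "b = s \<otimes> x" "s \<in> carrier R" ..
  show "a \<oplus> b \<in> (\<lambda>r. r \<otimes> x) ` carrier R"
    by (rule image_eqI[of _ _ "r \<oplus> s"]) (use assms r s in \<open>simp_all add: l_distr\<close>)
qed (use assms in auto)

text \<open>
  A character that is not faithful on \<open>P\<close> is trivial on \<open>R y\<close> for some nonzero \<open>y \<in> e R\<close>. There
  are fewer than \<open>|e R|\<close> such \<open>y\<close>, and each one excludes at most \<open>|R| / |e R|\<close> characters.
\<close>

lemma faithful_on_minimal_ideal_aux:
  assumes fin: "finite (carrier R)" and sp: "semiprime_ring R" and P: "ideal P R"
    and min: "\<And>I. ideal I R \<Longrightarrow> I \<subseteq> P \<Longrightarrow> I = {\<zero>} \<or> I = P"
    and e: "e \<in> P" "e \<noteq> \<zero>"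
    and le: "\<And>y. y \<in> P \<Longrightarrow> y \<noteq> \<zero> \<Longrightarrow>
      card ((\<lambda>r. e \<otimes> r) ` carrier R) \<le> card ((\<lambda>r. r \<otimes> y) ` carrier R)"
  shows "\<exists>\<chi>\<in>add_chars R. faithful_on R P \<chi>"
proof (rule ccontr)
  assume none: "\<not> ?thesis"
  interpret P: ideal P R by fact
  have ec: "e \<in> carrier R" using e P.Icarr by simp
  define E where "E = (\<lambda>r. e \<otimes> r) ` carrier R"
  define K where "K y = {\<chi> \<in> add_chars R. \<forall>t\<in>(\<lambda>r. r \<otimes> y) ` carrier R. \<chi> t = 1}" for y
  have finE: "finite E" using fin by (simp add: E_def)
  have EP: "E \<subseteq> P" using e P.I_r_closed by (auto simp: E_def)
  have E0: "\<zero> \<in> E" using ec by (auto simp: E_def intro!: image_eqI[of _ _ "\<zero>"])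
  \<comment> \<open>Z is an ideal inside P that misses e by semiprimeness, so minimality makes it
    zero. Hence every nonzero x in P has some e r x nonzero, and a witness against faithfulness can
    be moved into e R.\<close>
  define Z where "Z = {y \<in> P. \<forall>r\<in>carrier R. e \<otimes> r \<otimes> y = \<zero>}"
  have "ideal Z R"
  proof (rule idealI)
    show "subgroup Z (add_monoid R)"
      by (rule additive_subgroup.a_subgroup, rule a_subgroupI)
        (use ec P.Icarr a_subgroupD[OF P.additive_subgroup_axioms] in \<open>auto simp: Z_def r_distr r_minus\<close>)
    fix a x assume a: "a \<in> Z" and x: "x \<in> carrier R"
    have ac: "a \<in> P" "a \<in> carrier R" "\<And>r. r \<in> carrier R \<Longrightarrow> e \<otimes> r \<otimes> a = \<zero>"
      using a P.Icarr by (auto simp: Z_def)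
    have "e \<otimes> r \<otimes> (x \<otimes> a) = \<zero>" if "r \<in> carrier R" for r
      using ac(3)[of "r \<otimes> x"] that x ac ec by (simp add: m_assoc)
    then show "x \<otimes> a \<in> Z" using ac x P.I_l_closed by (auto simp: Z_def)
    have "e \<otimes> r \<otimes> (a \<otimes> x) = \<zero>" if "r \<in> carrier R" for r
      using ac(3)[of r] that x ac ec m_assoc[of "e \<otimes> r" a x] by simp
    then show "a \<otimes> x \<in> Z" using ac x P.I_r_closed by (auto simp: Z_def)
  qed (rule ring_axioms)
  moreover have "Z \<subseteq> P" by (auto simp: Z_def)
  moreover have "Z \<noteq> P"
    using semiprimeD[OF sp ec] e by (auto simp: Z_def)
  ultimately have Z: "Z = {\<zero>}" using min by blast
  have "add_chars R \<subseteq> (\<Union>y\<in>E - {\<zero>}. K y)"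
  proof
    fix \<chi> assume \<chi>: "\<chi> \<in> add_chars R"
    then have "\<not> faithful_on R P \<chi>" using none by blast
    then obtain x where x: "x \<in> P" "\<And>r. r \<in> carrier R \<Longrightarrow> \<chi> (r \<otimes> x) = 1" "x \<noteq> \<zero>"
      by (auto simp: faithful_on_def)
    have xc: "x \<in> carrier R" using x P.Icarr by simp
    have "x \<notin> Z" using x Z by simp
    then obtain r where r: "r \<in> carrier R" "e \<otimes> r \<otimes> x \<noteq> \<zero>" using x by (auto simp: Z_def)
    have "e \<otimes> r \<otimes> x \<in> E - {\<zero>}"
      using r xc ec by (auto simp: E_def m_assoc)
    moreover have "\<chi> (s \<otimes> (e \<otimes> r \<otimes> x)) = 1" if "s \<in> carrier R" for s
      using x(2)[of "s \<otimes> e \<otimes> r"] that r xc ec by (simp add: m_assoc)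
    ultimately show "\<chi> \<in> (\<Union>y\<in>E - {\<zero>}. K y)"
      using \<chi> by (auto simp: K_def)
  qed
  moreover have finK: "finite (K y)" for y
    using finite_add_chars[OF fin] by (simp add: K_def)
  ultimately have "card (add_chars R) \<le> card (\<Union>y\<in>E - {\<zero>}. K y)"
    using finE by (intro card_mono) auto
  also have "\<dots> \<le> (\<Sum>y\<in>E - {\<zero>}. card (K y))"
    using finE by (intro card_UN_le) auto
  \<comment> \<open>The union bound is multiplied by |e R| to avoid division. By \<open>le\<close>
    each summand is at most |R y| |K y| = |R|, and leaving out y = 0 makes the bound strictly too
    small.\<close>
  finally have "card E * card (carrier R) \<le> (\<Sum>y\<in>E - {\<zero>}. card E * card (K y))"
    using card_add_chars[OF fin] by (simp add: sum_distrib_left[symmetric])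
  also have "\<dots> \<le> (\<Sum>y\<in>E - {\<zero>}. card (carrier R))"
  proof (rule sum_mono)
    fix y assume y: "y \<in> E - {\<zero>}"
    then have "card E * card (K y) \<le> card ((\<lambda>r. r \<otimes> y) ` carrier R) * card (K y)"
      using le[of y] EP unfolding E_def by (intro mult_le_mono1) auto
    also have "\<dots> = card (carrier R)"
      unfolding K_def
      by (rule card_annihilator[OF fin left_multiples_subgroup]) (use y EP P.Icarr in auto)
    finally show "card E * card (K y) \<le> card (carrier R)" .
  qed
  also have "\<dots> = (card E - 1) * card (carrier R)"
    using finE E0 by simp
  finally have "card E * card (carrier R) \<le> (card E - 1) * card (carrier R)" .
  moreover have "card E > 0" "card (carrier R) > 0"
    using E0 finE fin zero_closed card_gt_0_iff by blast+
  ultimately show False by simp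
qed

end

lemma faithful_on_opp_opp [simp]: "faithful_on (opp_ring (opp_ring R)) I \<chi> = faithful_on R I \<chi>"
  by (simp add: faithful_on_def)

lemma ideal_if_ideal_opp_ring:
  assumes "ring R" "ideal I (opp_ring R)"
  shows "ideal I R"
proof -
  interpret R: ring R by fact
  interpret I: ideal I "opp_ring R" by fact
  note ID = I.a_subgroupD[OF I.additive_subgroup_axioms]
  have "\<ominus>\<^bsub>R\<^esub> x \<in> I" if "x \<in> I" for x
    using ID(4)[OF that] a_inv_opp_ring[OF assms(1), of x] I.Icarr[OF that] by simp
  then have "additive_subgroup I R"
    by (intro R.a_subgroupI) (use ID in auto)
  then show ?thesis
    using I.I_l_closed I.I_r_closed
    by (intro idealI additive_subgroup.a_subgroup R.ring_axioms) auto
qed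

context ring
begin

text \<open>The count needs some e with |e R| at most every |R y|. Let b minimise |b R| and a
  minimise |R a|. If |b R| is at most |R a|, then e = b works in R; otherwise e = a works in the
  opposite ring.\<close>

lemma faithful_on_minimal_ideal:
  assumes fin: "finite (carrier R)" and sp: "semiprime_ring R" and P: "ideal P R" "P \<noteq> {\<zero>}"
    and min: "\<And>I. ideal I R \<Longrightarrow> I \<subseteq> P \<Longrightarrow> I = {\<zero>} \<or> I = P"
  shows "\<exists>\<chi>\<in>add_chars R. faithful_on R P \<chi>"
proof -
  interpret P: ideal P R by fact
  interpret O: ring "opp_ring R" by (rule ring_opp_ring) (rule ring_axioms)
  let ?l = "\<lambda>y. card ((\<lambda>r. r \<otimes> y) ` carrier R)" and ?r = "\<lambda>y. card ((\<lambda>r. y \<otimes> r) ` carrier R)"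
  obtain x where x: "x \<in> P - {\<zero>}" using P(2) P.zero_closed by blast
  obtain a where a: "a \<in> P - {\<zero>}" "\<And>y. y \<in> P - {\<zero>} \<Longrightarrow> ?l a \<le> ?l y"
    using ex_has_least_nat[of "\<lambda>y. y \<in> P - {\<zero>}" x ?l] x by blast
  obtain b where b: "b \<in> P - {\<zero>}" "\<And>y. y \<in> P - {\<zero>} \<Longrightarrow> ?r b \<le> ?r y"
    using ex_has_least_nat[of "\<lambda>y. y \<in> P - {\<zero>}" x ?r] x by blast
  show ?thesis
  proof (cases "?r b \<le> ?l a")
    case True
    show ?thesis
    proof (rule faithful_on_minimal_ideal_aux[OF fin sp P(1) min])
      show "b \<in> P" "b \<noteq> \<zero>" using b(1) by auto
      show "?r b \<le> ?l y" if "y \<in> P" "y \<noteq> \<zero>" for y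
        using True a(2)[of y] that by simp
    qed
  next
    case False
    have "\<exists>\<chi>\<in>add_chars (opp_ring R). faithful_on (opp_ring R) P \<chi>"
    proof (rule O.faithful_on_minimal_ideal_aux)
      show "I = {\<zero>\<^bsub>opp_ring R\<^esub>} \<or> I = P" if "ideal I (opp_ring R)" "I \<subseteq> P" for I
        using min ideal_if_ideal_opp_ring[OF ring_axioms] that by simp
      show "card ((\<lambda>r. a \<otimes>\<^bsub>opp_ring R\<^esub> r) ` carrier (opp_ring R))
          \<le> card ((\<lambda>r. r \<otimes>\<^bsub>opp_ring R\<^esub> y) ` carrier (opp_ring R))"
        if "y \<in> P" "y \<noteq> \<zero>\<^bsub>opp_ring R\<^esub>" for y
        using b(2)[of y] that False by simp
    qed (use fin a ideal_opp_ring[OF P(1)] semiprime_opp_ring[OF ring_axioms sp] in auto)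
    then obtain \<chi> where \<chi>: "\<chi> \<in> add_chars R" "faithful_on (opp_ring R) P \<chi>" by auto
    \<comment> \<open>So far \<open>\<chi>\<close> detects only right multiples; symmetry of
      faithfulness on a semiprime ideal returns to left multiples.\<close>
    have "faithful_on (opp_ring (opp_ring R)) P \<chi>"
    proof (rule O.faithful_on_opp_ring)
      show "y = \<zero>\<^bsub>opp_ring R\<^esub>"
        if "y \<in> P" "\<And>p. p \<in> P \<Longrightarrow> p \<otimes>\<^bsub>opp_ring R\<^esub> y = \<zero>\<^bsub>opp_ring R\<^esub>" for y
        using O.semiprime_ideal_annihilator[OF semiprime_opp_ring[OF ring_axioms sp]
            ideal_opp_ring[OF P(1)] that] .
    qed (use fin \<chi> ideal_opp_ring[OF P(1)] in auto)
    then show ?thesis using \<chi>(1) by auto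
  qed
qed

text \<open>
  Glue a character that is faithful on a minimal ideal \<open>P \<subseteq> I\<close> with one that is faithful on its
  annihilator in \<open>I\<close>.
\<close>

lemma faithful_on_ideal:
  assumes fin: "finite (carrier R)" and sp: "semiprime_ring R" and I: "ideal I R"
  shows "\<exists>\<chi>\<in>add_chars R. faithful_on R I \<chi>"
  using I
proof (induction "card I" arbitrary: I rule: less_induct)
  case less
  interpret I: ideal I R by fact
  show ?case
  proof (cases "I = {\<zero>}")
    case True
    have "(\<lambda>x\<in>carrier R. 1) \<in> add_chars R"
      by (simp add: add_chars_def character_on_def)
    then show ?thesis using True by (auto simp: faithful_on_def)
  next
    case False
    have finI: "finite I" using I.a_subset fin finite_subset by blast
    obtain P where P: "ideal P R \<and> P \<noteq> {\<zero>} \<and> P \<subseteq> I"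
      and Pmin: "\<And>Q. ideal Q R \<and> Q \<noteq> {\<zero>} \<and> Q \<subseteq> I \<Longrightarrow> card P \<le> card Q"
      using ex_has_least_nat[of "\<lambda>P. ideal P R \<and> P \<noteq> {\<zero>} \<and> P \<subseteq> I" I card] less.prems False
      by blast
    interpret P: ideal P R using P by simp
    have min: "J = {\<zero>} \<or> J = P" if "ideal J R" "J \<subseteq> P" for J
    proof (cases "J = {\<zero>}")
      case False
      have "finite P" using P finI finite_subset by blast
      then show ?thesis
        using card_seteq[of P J] Pmin[of J] False that P by blast
    qed simp
    obtain \<chi>P where \<chi>P: "\<chi>P \<in> add_chars R" "faithful_on R P \<chi>P"
      using faithful_on_minimal_ideal[OF fin sp _ _ min] P by blast
    \<comment> \<open>The annihilator Q meets P in zero by semiprimeness. Thus it is strictly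
      smaller than I, the induction applies to it, and gluing is possible.\<close>
    define Q where "Q = {x \<in> I. \<forall>p\<in>P. p \<otimes> x = \<zero>}"
    have Q: "ideal Q R"
    proof (rule idealI)
      show "subgroup Q (add_monoid R)"
        by (rule additive_subgroup.a_subgroup, rule a_subgroupI)
          (use I.Icarr P.Icarr a_subgroupD[OF I.additive_subgroup_axioms] in \<open>auto simp: Q_def r_distr r_minus\<close>)
      fix a x assume a: "a \<in> Q" and x: "x \<in> carrier R"
      have ac: "a \<in> I" "a \<in> carrier R" "\<And>p. p \<in> P \<Longrightarrow> p \<otimes> a = \<zero>"
        using a I.Icarr by (auto simp: Q_def)
      have "p \<otimes> (x \<otimes> a) = \<zero>" if "p \<in> P" for p
        using ac(3)[OF P.I_r_closed[OF that x]] that x ac P.Icarr by (simp add: m_assoc)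
      then show "x \<otimes> a \<in> Q" using ac x I.I_l_closed by (auto simp: Q_def)
      have "p \<otimes> (a \<otimes> x) = \<zero>" if "p \<in> P" for p
        using ac(3)[OF that] that x ac P.Icarr m_assoc[of p a x] by simp
      then show "a \<otimes> x \<in> Q" using ac x I.I_r_closed by (auto simp: Q_def)
    qed (rule ring_axioms)
    have ann: "y = \<zero>" if "y \<in> P" "\<And>p. p \<in> P \<Longrightarrow> p \<otimes> y = \<zero>" for y
      using semiprime_ideal_annihilator[OF sp _ that] P by blast
    have PQ: "P \<inter> Q = {\<zero>}"
    proof
      show "P \<inter> Q \<subseteq> {\<zero>}"
      proof
        fix y assume "y \<in> P \<inter> Q"
        then have "y \<in> P" "\<And>p. p \<in> P \<Longrightarrow> p \<otimes> y = \<zero>" by (simp_all add: Q_def)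
        from ann[OF this] show "y \<in> {\<zero>}" by simp
      qed
      show "{\<zero>} \<subseteq> P \<inter> Q"
        using P.zero_closed P.Icarr I.zero_closed by (simp add: Q_def)
    qed
    have "Q \<noteq> I"
      using PQ P by blast
    then have "Q \<subset> I"
      by (auto simp: Q_def)
    then have "card Q < card I"
      using finI by (simp add: psubset_card_mono)
    from less.hyps[OF this Q] obtain \<chi>Q where \<chi>Q: "\<chi>Q \<in> add_chars R" "faithful_on R Q \<chi>Q"
      by blast
    interpret Q: ideal Q R by (rule Q)
    obtain \<chi> where \<chi>: "\<chi> \<in> add_chars R" "\<And>x. x \<in> P \<Longrightarrow> \<chi> x = \<chi>P x" "\<And>x. x \<in> Q \<Longrightarrow> \<chi> x = \<chi>Q x"
      using character_glue[OF fin P.additive_subgroup_axioms Q.additive_subgroup_axioms PQ,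
          of \<chi>P \<chi>Q] character_on_subset[OF add_charsD P.a_subset] \<chi>P(1)
        character_on_subset[OF add_charsD Q.a_subset] \<chi>Q(1) by metis
    have "faithful_on R I \<chi>"
      unfolding faithful_on_def
    proof (intro ballI impI)
      fix x assume x: "x \<in> I" "\<forall>r\<in>carrier R. \<chi> (r \<otimes> x) = 1"
      have xc: "x \<in> carrier R" using x I.Icarr by simp
      \<comment> \<open>On P the glued character is \<open>\<chi>P\<close>, which is trivial on R p
        x; so P annihilates x. This puts x into Q, where \<open>\<chi>Q\<close> finishes.\<close>
      have "p \<otimes> x = \<zero>" if p: "p \<in> P" for p
      proof (rule faithful_onD[OF \<chi>P(2)])
        show pxP: "p \<otimes> x \<in> P" using p xc P.I_r_closed by simp
        show "\<chi>P (r \<otimes> (p \<otimes> x)) = 1" if "r \<in> carrier R" for r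
          using \<chi>(2)[OF P.I_l_closed[OF pxP that]] x(2) that p xc P.Icarr
          by (metis m_assoc m_closed)
      qed
      then have xQ: "x \<in> Q" using x by (simp add: Q_def)
      show "x = \<zero>"
        by (rule faithful_onD[OF \<chi>Q(2) xQ]) (use \<chi>(3)[OF Q.I_l_closed[OF xQ]] x(2) in auto)
    qed
    then show ?thesis using \<chi>(1) by blast
  qed
qed

lemma semiprime_faithful_character:
  assumes "finite (carrier R)" "semiprime_ring R"
  obtains \<chi> where "\<chi> \<in> add_chars R" "faithful_on R (carrier R) \<chi>"
  using faithful_on_ideal[OF assms oneideal] by blast

end

subsection \<open>The Jacobson radical of a finite ring\<close>

abbreviation left_ideal :: "'a set \<Rightarrow> ('a, 'm) ring_scheme \<Rightarrow> bool" where
  "left_ideal I R \<equiv> submodule I R (regular_module R)"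

abbreviation maximal_left_ideal :: "'a set \<Rightarrow> ('a, 'm) ring_scheme \<Rightarrow> bool" where
  "maximal_left_ideal I R \<equiv> maximal_submodule I R (regular_module R)"

lemma regular_module_simps [simp]:
  "carrier (regular_module R) = carrier R"
  "ring.zero (regular_module R) = ring.zero R"
  "add (regular_module R) = add R"
  "smult (regular_module R) = monoid.mult R"
  by (simp_all add: regular_module_def)

lemma left_ideal_iff:
  "left_ideal I R \<longleftrightarrow>
     additive_subgroup I R \<and> (\<forall>r\<in>carrier R. \<forall>x\<in>I. r \<otimes>\<^bsub>R\<^esub> x \<in> I)"
  by (auto simp: submodule_def submodule_axioms_def additive_subgroup_def subgroup_def m_inv_def)

lemma left_ideal_opp_opp [simp]: "left_ideal I (opp_ring (opp_ring R)) = left_ideal I R"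
  by (simp add: left_ideal_iff additive_subgroup_def subgroup_def m_inv_def)

lemma jacobson_radical_opp_opp [simp]:
  "jacobson_radical (opp_ring (opp_ring R)) = jacobson_radical R"
  by (simp add: jacobson_radical_def maximal_submodule_def)

context ring
begin

lemma left_idealD:
  assumes "left_ideal I R"
  shows "additive_subgroup I R" "I \<subseteq> carrier R" "\<zero> \<in> I" "\<And>x y. x \<in> I \<Longrightarrow> y \<in> I \<Longrightarrow> x \<oplus> y \<in> I"
    "\<And>x. x \<in> I \<Longrightarrow> \<ominus> x \<in> I" "\<And>r x. r \<in> carrier R \<Longrightarrow> x \<in> I \<Longrightarrow> r \<otimes> x \<in> I"
  using assms a_subgroupD[of I] by (auto simp: left_ideal_iff)

lemma left_idealI:
  assumes "I \<subseteq> carrier R" "\<zero> \<in> I" "\<And>x y. x \<in> I \<Longrightarrow> y \<in> I \<Longrightarrow> x \<oplus> y \<in> I"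
    "\<And>r x. r \<in> carrier R \<Longrightarrow> x \<in> I \<Longrightarrow> r \<otimes> x \<in> I"
  shows "left_ideal I R"
proof -
  have "\<ominus> x \<in> I" if "x \<in> I" for x
  proof -
    have "x \<in> carrier R" using that assms(1) by blast
    then have "\<ominus> x = (\<ominus> \<one>) \<otimes> x" by (simp add: l_minus)
    then show ?thesis using assms(4)[OF _ that, of "\<ominus> \<one>"] by simp
  qed
  then show ?thesis
    using assms by (auto simp: left_ideal_iff intro!: a_subgroupI)
qed

lemma left_ideal_one: "left_ideal I R \<Longrightarrow> \<one> \<in> I \<Longrightarrow> I = carrier R"
  using left_idealD[of I] by (metis r_one subsetI subset_antisym)

lemma principal_left_ideal:
  assumes "x \<in> carrier R"
  shows "left_ideal ((\<lambda>r. r \<otimes> x) ` carrier R) R"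
proof -
  have "r \<otimes> y \<in> (\<lambda>r. r \<otimes> x) ` carrier R"
    if r: "r \<in> carrier R" and "y \<in> (\<lambda>r. r \<otimes> x) ` carrier R" for r y
  proof -
    from that(2) obtain s where "y = s \<otimes> x" "s \<in> carrier R" ..
    then show ?thesis
      using r assms by (intro image_eqI[of _ _ "r \<otimes> s"]) (simp_all add: m_assoc)
  qed
  then show ?thesis
    using left_multiples_subgroup[OF assms] by (simp add: left_ideal_iff)
qed

lemma in_principal_left_ideal: "x \<in> carrier R \<Longrightarrow> x \<in> (\<lambda>r. r \<otimes> x) ` carrier R"
  by (rule image_eqI[of _ _ \<one>]) simp_all

lemma maximal_left_idealD:
  assumes "maximal_left_ideal M R"
  shows "left_ideal M R" "M \<noteq> carrier R" "\<one> \<notin> M" "M \<subseteq> carrier R"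
    "\<And>N. left_ideal N R \<Longrightarrow> M \<subseteq> N \<Longrightarrow> N = M \<or> N = carrier R"
  using assms left_ideal_one left_idealD by (auto simp: maximal_submodule_def)

text \<open>M + R x is a left ideal strictly larger than M. Mostly used with z = 1.\<close>

lemma maximal_left_ideal_sum:
  assumes M: "maximal_left_ideal M R" and x: "x \<in> carrier R" "x \<notin> M" and z: "z \<in> carrier R"
  obtains m r where "m \<in> M" "r \<in> carrier R" "z = m \<oplus> r \<otimes> x"
proof -
  note MD = left_idealD[OF maximal_left_idealD(1)[OF M]]
  define N where "N = {y. \<exists>m\<in>M. \<exists>r\<in>carrier R. y = m \<oplus> r \<otimes> x}"
  have N: "left_ideal N R"
  proof (rule left_idealI)
    show "N \<subseteq> carrier R" using MD x by (auto simp: N_def)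
    show "\<zero> \<in> N" using MD x by (auto simp: N_def intro!: bexI[of _ \<zero>])
  next
    fix a b assume "a \<in> N" "b \<in> N"
    then obtain m r m' r' where *: "m \<in> M" "r \<in> carrier R" "a = m \<oplus> r \<otimes> x"
      "m' \<in> M" "r' \<in> carrier R" "b = m' \<oplus> r' \<otimes> x"
      unfolding N_def by blast
    moreover have "m \<in> carrier R" "m' \<in> carrier R" using * MD by auto
    ultimately have "a \<oplus> b = (m \<oplus> m') \<oplus> (r \<oplus> r') \<otimes> x"
      using x by (simp add: l_distr a_ac)
    then show "a \<oplus> b \<in> N" using * MD by (auto simp: N_def)
  next
    fix s a assume s: "s \<in> carrier R" and "a \<in> N"
    then obtain m r where *: "m \<in> M" "r \<in> carrier R" "a = m \<oplus> r \<otimes> x"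
      unfolding N_def by blast
    moreover have "m \<in> carrier R" using * MD by auto
    ultimately have "s \<otimes> a = s \<otimes> m \<oplus> (s \<otimes> r) \<otimes> x"
      using x s by (simp add: r_distr m_assoc)
    moreover have "s \<otimes> m \<in> M" "s \<otimes> r \<in> carrier R" using * s MD by auto
    ultimately show "s \<otimes> a \<in> N" unfolding N_def by blast
  qed
  have "M \<subseteq> N"
  proof
    fix m assume "m \<in> M"
    then have "m = m \<oplus> \<zero> \<otimes> x"
      using MD(2) x by auto
    with \<open>m \<in> M\<close> show "m \<in> N" unfolding N_def by blast
  qed
  moreover have "x = \<zero> \<oplus> \<one> \<otimes> x"
    using x by simp
  then have "x \<in> N"
    unfolding N_def using MD(3) by blast
  ultimately have "N = carrier R"
    using maximal_left_idealD(5)[OF M N] x by blast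
  then show ?thesis
    using z that by (auto simp: N_def)
qed

lemma maximal_left_ideal_exists:
  assumes fin: "finite (carrier R)" and L: "left_ideal L R" "L \<noteq> carrier R"
  obtains M where "maximal_left_ideal M R" "L \<subseteq> M"
proof -
  let ?P = "\<lambda>M. left_ideal M R \<and> M \<noteq> carrier R \<and> L \<subseteq> M"
  have "\<exists>M. ?P M \<and> (\<forall>N. ?P N \<longrightarrow> card N \<le> card M)"
    by (rule ex_has_greatest_nat[of ?P L card "card (carrier R) + 1"])
      (use L fin left_idealD(2) in \<open>auto intro!: le_imp_less_Suc card_mono\<close>)
  then obtain M where M: "?P M" "\<And>N. ?P N \<Longrightarrow> card N \<le> card M" by blast
  have "maximal_left_ideal M R"
    unfolding maximal_submodule_def
  proof (intro conjI allI impI)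
    fix N assume N: "left_ideal N R \<and> M \<subseteq> N"
    have "finite N" using N fin finite_subset left_idealD(2) by blast
    then show "N = M \<or> N = carrier (regular_module R)"
      using M(2)[of N] M(1) N card_seteq[of N M] by auto
  qed (use M in auto)
  then show ?thesis using M that by blast
qed

text \<open>
  This makes the radical, an intersection of maximal left ideals, a two-sided ideal.
\<close>

lemma maximal_left_ideal_colon:
  assumes M: "maximal_left_ideal M R" and r: "r \<in> carrier R" "r \<notin> M"
  shows "maximal_left_ideal {x \<in> carrier R. x \<otimes> r \<in> M} R"
proof -
  note MD = left_idealD[OF maximal_left_idealD(1)[OF M]]
  let ?N = "{x \<in> carrier R. x \<otimes> r \<in> M}"
  have N: "left_ideal ?N R"
    by (rule left_idealI) (use r MD in \<open>auto simp: l_distr m_assoc\<close>)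
  have "L = carrier R" if L: "left_ideal L R" "?N \<subseteq> L" "L \<noteq> ?N" for L
  proof -
    note LD = left_idealD[OF L(1)]
    obtain x where x: "x \<in> L" "x \<notin> ?N" using L by blast
    have xc: "x \<in> carrier R" using x LD by blast
    have "x \<otimes> r \<in> carrier R" "x \<otimes> r \<notin> M" using x xc r by auto
    then obtain m a where ma: "m \<in> M" "a \<in> carrier R" "r = m \<oplus> a \<otimes> (x \<otimes> r)"
      using maximal_left_ideal_sum[OF M _ _ r(1)] by blast
    have mc: "m \<in> carrier R" using ma MD by blast
    \<comment> \<open>The relation r = m + a x r says that 1 - a x multiplies r into M, so 1 - a x
      lies in L; as a x does too, L contains 1.\<close>
    have "m = (\<one> \<ominus> a \<otimes> x) \<otimes> r"
    proof -
      have "(\<one> \<ominus> a \<otimes> x) \<otimes> r = r \<ominus> a \<otimes> (x \<otimes> r)"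
        using r xc ma by (simp add: minus_eq l_distr l_minus m_assoc)
      also have "\<dots> = (m \<oplus> a \<otimes> (x \<otimes> r)) \<ominus> a \<otimes> (x \<otimes> r)"
        using ma(3) by simp
      also have "\<dots> = m"
        using mc ma(2) xc r by (simp add: minus_eq a_assoc r_neg)
      finally show ?thesis by simp
    qed
    then have "\<one> \<ominus> a \<otimes> x \<in> L"
      using ma xc L(2) by auto
    moreover have "a \<otimes> x \<in> L" using LD x ma by blast
    ultimately have "(\<one> \<ominus> a \<otimes> x) \<oplus> a \<otimes> x \<in> L" using LD(4) by blast
    then have "\<one> \<in> L"
      using xc ma by (simp add: minus_eq a_assoc l_neg)
    then show ?thesis using left_ideal_one L(1) by blast
  qed
  moreover have "\<one> \<notin> ?N" using r by simp
  then have "?N \<noteq> carrier R" using one_closed by metis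
  ultimately show ?thesis
    using N unfolding maximal_submodule_def regular_module_simps by blast
qed

lemma jacobson_radicalD:
  "j \<in> jacobson_radical R \<Longrightarrow> j \<in> carrier R"
  "j \<in> jacobson_radical R \<Longrightarrow> maximal_left_ideal M R \<Longrightarrow> j \<in> M"
  by (auto simp: jacobson_radical_def)

lemma jacobson_radicalI:
  "j \<in> carrier R \<Longrightarrow> (\<And>M. maximal_left_ideal M R \<Longrightarrow> j \<in> M) \<Longrightarrow> j \<in> jacobson_radical R"
  by (auto simp: jacobson_radical_def)

text \<open>For a x with a in J, let M be maximal. If x is in M, then so is a x. Otherwise the
  elements that multiply x into M form a maximal left ideal, which contains a.\<close>

lemma ideal_jacobson_radical: "ideal (jacobson_radical R) R"
proof -
  let ?J = "jacobson_radical R"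
  have J: "left_ideal ?J R"
  proof (rule left_idealI)
    show "x \<oplus> y \<in> ?J" if "x \<in> ?J" "y \<in> ?J" for x y
    proof (rule jacobson_radicalI)
      fix M assume "maximal_left_ideal M R"
      then show "x \<oplus> y \<in> M"
        using that jacobson_radicalD(2) left_idealD(4)[OF maximal_left_idealD(1)] by blast
    qed (use that jacobson_radicalD(1) in auto)
    show "r \<otimes> x \<in> ?J" if "r \<in> carrier R" "x \<in> ?J" for r x
    proof (rule jacobson_radicalI)
      fix M assume "maximal_left_ideal M R"
      then show "r \<otimes> x \<in> M"
        using that jacobson_radicalD(2) left_idealD(6)[OF maximal_left_idealD(1)] by blast
    qed (use that jacobson_radicalD(1) in auto)
    show "\<zero> \<in> ?J"
      by (rule jacobson_radicalI) (use maximal_left_idealD(1) left_idealD(3) in auto)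
  qed (use jacobson_radicalD(1) in auto)
  show ?thesis
  proof (rule idealI)
    show "subgroup ?J (add_monoid R)"
      using left_idealD(1)[OF J] by (rule additive_subgroup.a_subgroup)
    fix a x assume a: "a \<in> ?J" and x: "x \<in> carrier R"
    show "x \<otimes> a \<in> ?J" using left_idealD(6)[OF J] a x by blast
    show "a \<otimes> x \<in> ?J"
    proof (rule jacobson_radicalI)
      show "a \<otimes> x \<in> carrier R" using a x jacobson_radicalD(1) by simp
      fix M assume M: "maximal_left_ideal M R"
      show "a \<otimes> x \<in> M"
      proof (cases "x \<in> M")
        case True
        then show ?thesis
          using left_idealD(6)[OF maximal_left_idealD(1)[OF M]] a jacobson_radicalD(1) by blast
      next
        case False
        then show ?thesis
          using jacobson_radicalD(2)[OF a maximal_left_ideal_colon[OF M x]] by simp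
      qed
    qed
  qed (rule ring_axioms)
qed

text \<open>No maximal left ideal contains 1 - j, as it would then contain 1; so 1 - j has a left
  inverse. Left multiplication by 1 - j is therefore injective, and finiteness makes it
  surjective.\<close>

lemma jacobson_radical_right_invertible:
  assumes fin: "finite (carrier R)" and j: "j \<in> jacobson_radical R"
  obtains w where "w \<in> carrier R" "(\<one> \<ominus> j) \<otimes> w = \<one>"
proof -
  have jc: "j \<in> carrier R" using j jacobson_radicalD by blast
  define y where "y = \<one> \<ominus> j"
  have yc: "y \<in> carrier R" using jc by (simp add: y_def)
  have "(\<lambda>r. r \<otimes> y) ` carrier R = carrier R"
  proof (rule ccontr)
    assume "(\<lambda>r. r \<otimes> y) ` carrier R \<noteq> carrier R"
    then obtain M where M: "maximal_left_ideal M R" "(\<lambda>r. r \<otimes> y) ` carrier R \<subseteq> M"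
      using maximal_left_ideal_exists[OF fin principal_left_ideal[OF yc]] by blast
    have "y \<in> M" "j \<in> M"
      using M in_principal_left_ideal[OF yc] jacobson_radicalD(2)[OF j M(1)] by auto
    then have "y \<oplus> j \<in> M" using left_idealD(4)[OF maximal_left_idealD(1)[OF M(1)]] by blast
    then show False
      using maximal_left_idealD(3)[OF M(1)] jc by (simp add: y_def minus_eq a_assoc l_neg)
  qed
  then obtain u where u: "u \<in> carrier R" "u \<otimes> y = \<one>"
    by (metis imageE one_closed)
  have "inj_on (\<lambda>x. y \<otimes> x) (carrier R)"
    by (rule inj_on_inverseI[of _ "\<lambda>x. u \<otimes> x"]) (use u yc in \<open>simp add: m_assoc[symmetric]\<close>)
  then have "(\<lambda>x. y \<otimes> x) ` carrier R = carrier R"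
    using endo_inj_surj[OF fin] yc by blast
  then obtain w where "w \<in> carrier R" "y \<otimes> w = \<one>"
    by (metis imageE one_closed)
  then show ?thesis using that by (simp add: y_def)
qed

text \<open>If a maximal right ideal M missed j, then 1 = m + j r with m in M. Since j r is in the
  radical, m = 1 - j r has a right inverse, which forces 1 into M.\<close>

lemma jacobson_radical_subset_opp:
  assumes fin: "finite (carrier R)"
  shows "jacobson_radical R \<subseteq> jacobson_radical (opp_ring R)"
proof
  interpret O: ring "opp_ring R" by (rule ring_opp_ring) (rule ring_axioms)
  interpret J: ideal "jacobson_radical R" R by (rule ideal_jacobson_radical)
  fix j assume j: "j \<in> jacobson_radical R"
  have jc: "j \<in> carrier R" using j jacobson_radicalD by blast
  show "j \<in> jacobson_radical (opp_ring R)"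
  proof (rule O.jacobson_radicalI)
    fix M assume M: "maximal_left_ideal M (opp_ring R)"
    note MD = O.left_idealD[OF O.maximal_left_idealD(1)[OF M]]
    show "j \<in> M"
    proof (rule ccontr)
      assume "j \<notin> M"
      then obtain m r where mr: "m \<in> M" "r \<in> carrier R" "\<one> = m \<oplus> j \<otimes> r"
        using O.maximal_left_ideal_sum[OF M, of j "\<one>"] jc by auto
      have mc: "m \<in> carrier R" using mr MD by auto
      have jr: "j \<otimes> r \<in> jacobson_radical R" using J.I_r_closed j mr by blast
      obtain w where w: "w \<in> carrier R" "(\<one> \<ominus> j \<otimes> r) \<otimes> w = \<one>"
        using jacobson_radical_right_invertible[OF fin jr] .
      have "\<one> \<ominus> j \<otimes> r = (m \<oplus> j \<otimes> r) \<ominus> j \<otimes> r" using mr(3) by simp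
      then have "\<one> \<ominus> j \<otimes> r = m"
        using mc jc mr(2) by (simp add: minus_eq a_assoc r_neg)
      then have "\<one> \<in> M"
        using MD(6)[of w m] w mr(1) by simp
      then show False using O.maximal_left_idealD(3)[OF M] by simp
    qed
  qed (use jc in simp)
qed

lemma jacobson_radical_opp_ring:
  assumes "finite (carrier R)"
  shows "jacobson_radical (opp_ring R) = jacobson_radical R"
  using jacobson_radical_subset_opp[OF assms]
    ring.jacobson_radical_subset_opp[OF ring_opp_ring[OF ring_axioms]] assms by auto

text \<open>Let a R a lie in J. If a maximal left ideal M missed a, then 1 = m + r a, and a = a m +
  a r a would be in M.\<close>

lemma semiprime_quotient_jacobson: "semiprime_ring (R Quot jacobson_radical R)"
proof -
  let ?J = "jacobson_radical R"
  interpret J: ideal ?J R by (rule ideal_jacobson_radical)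
  interpret S: ring "R Quot ?J" by (rule J.quotient_is_ring)
  note JD = J.Icarr
  show ?thesis
    unfolding semiprime_ring_def
  proof (intro ballI impI)
    fix A assume A: "A \<in> carrier (R Quot ?J)"
      and 0: "\<forall>B\<in>carrier (R Quot ?J). A \<otimes>\<^bsub>R Quot ?J\<^esub> B \<otimes>\<^bsub>R Quot ?J\<^esub> A = \<zero>\<^bsub>R Quot ?J\<^esub>"
    obtain a where a: "a \<in> carrier R" "A = ?J +> a"
      using A by (auto simp: FactRing_def A_RCOSETS_def')
    have J: "a \<otimes> r \<otimes> a \<in> ?J" if r: "r \<in> carrier R" for r
    proof -
      have "?J +> r \<in> carrier (R Quot ?J)"
        using r by (auto simp: FactRing_def A_RCOSETS_def')
      then have "?J +> (a \<otimes> r \<otimes> a) = ?J"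
        using 0 a r by (auto simp: FactRing_def J.rcoset_mult_add)
      then show ?thesis
        using J.a_rcos_self[of "a \<otimes> r \<otimes> a"] a r by simp
    qed
    have "a \<in> ?J"
    proof (rule jacobson_radicalI)
      fix M assume M: "maximal_left_ideal M R"
      note MD = left_idealD[OF maximal_left_idealD(1)[OF M]]
      show "a \<in> M"
      proof (rule ccontr)
        assume "a \<notin> M"
        then obtain m r where mr: "m \<in> M" "r \<in> carrier R" "\<one> = m \<oplus> r \<otimes> a"
          using maximal_left_ideal_sum[OF M a(1) _ one_closed] by blast
        have mc: "m \<in> carrier R" using mr MD by blast
        have "a = a \<otimes> (m \<oplus> r \<otimes> a)"
          using r_one[OF a(1)] by (simp only: mr(3)[symmetric])
        then have "a = a \<otimes> m \<oplus> a \<otimes> r \<otimes> a"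
          using a mc mr(2) by (simp add: r_distr m_assoc)
        moreover have "a \<otimes> m \<in> M" "a \<otimes> r \<otimes> a \<in> M"
          using MD a mr J jacobson_radicalD(2)[OF _ M] by auto
        ultimately have "a \<in> M" using MD(4) by metis
        then show False using \<open>a \<notin> M\<close> by simp
      qed
    qed (rule a(1))
    then have "A = ?J" using a a_rcos_zero[OF J.ideal_axioms] by simp
    then show "A = \<zero>\<^bsub>R Quot ?J\<^esub>" by (simp add: FactRing_def)
  qed
qed

lemma quotient_jacobson_character:
  assumes fin: "finite (carrier R)"
  obtains \<chi> where "\<chi> \<in> add_chars (R Quot jacobson_radical R)"
    "faithful_on (R Quot jacobson_radical R) (carrier (R Quot jacobson_radical R)) \<chi>"
proof -
  interpret J: ideal "jacobson_radical R" R by (rule ideal_jacobson_radical)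
  have "finite (carrier (R Quot jacobson_radical R))"
    using fin by (simp add: FactRing_def A_RCOSETS_def')
  then show ?thesis
    using ring.semiprime_faithful_character[OF J.quotient_is_ring _ semiprime_quotient_jacobson] that
    by blast
qed

end

subsection \<open>The socle and faithful characters\<close>

lemma coset_regular_module [simp]:
  "a_r_coset (regular_module R) = a_r_coset R"
  "A_RCOSETS (regular_module R) = A_RCOSETS R"
  "set_add (regular_module R) = set_add R"
  by (simp_all add: fun_eq_iff a_r_coset_def' A_RCOSETS_def' set_add_def')

lemma quotient_regular_simps [simp]:
  "carrier (quotient_module (regular_module R) I) = carrier (R Quot I)"
  "add (quotient_module (regular_module R) I) = add (R Quot I)"
  by (simp_all add: quotient_module_def FactRing_def)

lemma (in ideal) coset_in_quotient: "a \<in> carrier R \<Longrightarrow> I +> a \<in> carrier (R Quot I)"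
  by (auto simp: FactRing_def A_RCOSETS_def')

lemma (in ideal) quotient_cases:
  assumes "C \<in> carrier (R Quot I)"
  obtains a where "a \<in> carrier R" "C = I +> a"
  using assms by (auto simp: FactRing_def A_RCOSETS_def')

lemma (in ideal) coset_eq_iff_zero:
  "a \<in> carrier R \<Longrightarrow> I +> a = I \<longleftrightarrow> a \<in> I"
  using a_rcos_zero[OF ideal_axioms] a_rcos_self by blast

text \<open>The coset of r x depends only on the coset of x, so the union in
  \<open>quotient_module\<close> runs over copies of a single coset. The module structure can thus
  be computed in the quotient ring.\<close>

lemma (in ideal) quotient_smult:
  assumes "r \<in> carrier R" "C \<in> carrier (R Quot I)"
  shows "r \<odot>\<^bsub>quotient_module (regular_module R) I\<^esub> C = (I +> r) \<otimes>\<^bsub>R Quot I\<^esub> C"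
proof -
  obtain a where a: "a \<in> carrier R" "C = I +> a"
    using assms(2) by (rule quotient_cases)
  have "I +> (r \<otimes> x) = I +> (r \<otimes> a)" if "x \<in> C" for x
  proof -
    have "I +> x = I +> a"
      using a_repr_independence'[of x a] that a by simp
    moreover have "x \<in> carrier R"
      using that a a_r_coset_subset_G[OF a_subset a(1)] by blast
    ultimately show ?thesis
      using rcoset_mult_add[OF assms(1)] a(1) by metis
  qed
  moreover have "a \<in> C" using a a_rcos_self by simp
  ultimately have "(\<Union>x\<in>C. I +> (r \<otimes> x)) = I +> (r \<otimes> a)" by blast
  then show ?thesis
    using a assms(1) by (simp add: quotient_module_def FactRing_def rcoset_mult_add)
qed

context ring
begin

lemma socle_subgroup: "additive_subgroup (socle R (regular_module R)) R"
proof -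
  have "\<Union>{S. simple_submodule S R (regular_module R)} \<subseteq> carrier R"
    using left_idealD(2) by (auto simp: simple_submodule_def)
  then have "subgroup (generate (add_monoid R) (\<Union>{S. simple_submodule S R (regular_module R)})) (add_monoid R)"
    by (intro add.generate_is_subgroup) simp
  \<comment> \<open>The two additive monoids share their operations but belong to different record
    types, so the generated sets are compared by induction.\<close>
  moreover have "generate (add_monoid (regular_module R)) A = generate (add_monoid R) A" for A
  proof (intro equalityI subsetI)
    show "x \<in> generate (add_monoid R) A" if "x \<in> generate (add_monoid (regular_module R)) A" for x
      using that
    proof induction
      case (inv h)
      then show ?case
        using generate.inv[OF inv, of "add_monoid R"] by (simp add: m_inv_def)
    next
      case (eng h1 h2)
      then show ?case
        using generate.eng[of h1 "add_monoid R" A h2] by simp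
    qed (use generate.one[of "add_monoid R" A] generate.incl[of _ A "add_monoid R"] in auto)
    show "x \<in> generate (add_monoid (regular_module R)) A" if "x \<in> generate (add_monoid R) A" for x
      using that
    proof induction
      case (inv h)
      then show ?case
        using generate.inv[OF inv, of "add_monoid (regular_module R)"] by (simp add: m_inv_def)
    next
      case (eng h1 h2)
      then show ?case
        using generate.eng[of h1 "add_monoid (regular_module R)" A h2] by simp
    qed (use generate.one[of "add_monoid (regular_module R)" A] generate.incl[of _ A "add_monoid (regular_module R)"] in auto)
  qed
  ultimately show ?thesis
    by (simp add: additive_subgroup_def socle_def)
qed

lemma simple_subset_socle:
  "simple_submodule S R (regular_module R) \<Longrightarrow> S \<subseteq> socle R (regular_module R)"
  by (auto simp: socle_def intro!: generate.incl)

lemma socle_least: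
  assumes "additive_subgroup H R" "\<And>S. simple_submodule S R (regular_module R) \<Longrightarrow> S \<subseteq> H"
  shows "socle R (regular_module R) \<subseteq> H"
proof
  note HD = a_subgroupD[OF assms(1)]
  have m_inv: "inv\<^bsub>add_monoid (regular_module R)\<^esub> h = \<ominus> h" for h
    by (simp add: a_inv_def m_inv_def)
  fix x assume "x \<in> socle R (regular_module R)"
  then show "x \<in> H"
    unfolding socle_def
  proof induction
    case (inv h)
    then have "h \<in> H" using assms(2) by blast
    then show ?case
      unfolding m_inv by (rule HD(4))
  next
    case (incl h)
    then show ?case using assms(2) by blast
  qed (use HD in simp_all)
qed

text \<open>R y is a nonzero image of the simple module R/M under r -> r y. Concretely, a submodule
  N of R y pulls back to a left ideal L that contains M.\<close>

lemma simple_submodule_principal: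
  assumes M: "maximal_left_ideal M R" and y: "y \<in> carrier R" "y \<noteq> \<zero>"
    and My: "\<And>m. m \<in> M \<Longrightarrow> m \<otimes> y = \<zero>"
  shows "simple_submodule ((\<lambda>r. r \<otimes> y) ` carrier R) R (regular_module R)"
  unfolding simple_submodule_def
proof (intro conjI allI impI)
  let ?Y = "(\<lambda>r. r \<otimes> y) ` carrier R"
  show "left_ideal ?Y R" by (rule principal_left_ideal[OF y(1)])
  show "?Y \<noteq> {\<zero>\<^bsub>regular_module R\<^esub>}"
    using in_principal_left_ideal[OF y(1)] y(2) by auto
  fix N assume N: "left_ideal N R \<and> N \<subseteq> ?Y"
  then have "left_ideal N R" by blast
  note ND = left_idealD[OF this]
  define L where "L = {x \<in> carrier R. x \<otimes> y \<in> N}"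
  have "left_ideal L R"
    by (rule left_idealI) (use ND y in \<open>auto simp: L_def l_distr m_assoc\<close>)
  moreover have "M \<subseteq> L"
    using My ND(3) maximal_left_idealD(4)[OF M] by (auto simp: L_def)
  ultimately consider "L = M" | "L = carrier R"
    using maximal_left_idealD(5)[OF M] by blast
  then show "N = {\<zero>\<^bsub>regular_module R\<^esub>} \<or> N = ?Y"
  proof cases
    case 1
    have "n = \<zero>" if n: "n \<in> N" for n
    proof -
      obtain r where r: "n = r \<otimes> y" "r \<in> carrier R" using n N by blast
      then have "r \<in> M" using 1 n by (auto simp: L_def)
      then show ?thesis using My r by simp
    qed
    then have "N = {\<zero>}" using ND(3) by blast
    then show ?thesis by simp
  next
    case 2
    then have "?Y \<subseteq> N" by (auto simp: L_def)
    then show ?thesis using N by blast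
  qed
qed

text \<open>The annihilator of a nonzero x in S is a maximal left ideal, hence contains J. Indeed,
  if r x is nonzero, simplicity gives x = a r x, so 1 - a r annihilates x.\<close>

lemma jacobson_radical_kills_simple:
  assumes S: "simple_submodule S R (regular_module R)" and x: "x \<in> S" and j: "j \<in> jacobson_radical R"
  shows "j \<otimes> x = \<zero>"
proof (cases "x = \<zero>")
  case True
  then show ?thesis using j jacobson_radicalD by simp
next
  case False
  have LS: "left_ideal S R" using S by (simp add: simple_submodule_def)
  note SD = left_idealD[OF LS]
  have xc: "x \<in> carrier R" using x SD by blast
  let ?A = "{r \<in> carrier R. r \<otimes> x = \<zero>}"
  have A: "left_ideal ?A R"
    by (rule left_idealI) (use xc in \<open>auto simp: l_distr m_assoc\<close>)
  have one: "\<one> \<notin> ?A" using False xc by simp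
  have "L = carrier R" if L: "left_ideal L R" "?A \<subseteq> L" "L \<noteq> ?A" for L
  proof -
    note LD = left_idealD[OF L(1)]
    obtain r where r: "r \<in> L" "r \<notin> ?A" using L by blast
    have rc: "r \<in> carrier R" using r LD by blast
    have rx: "r \<otimes> x \<in> carrier R" "r \<otimes> x \<noteq> \<zero>" using r rc xc by auto
    have "(\<lambda>a. a \<otimes> (r \<otimes> x)) ` carrier R \<subseteq> S"
      using SD x rc by auto
    moreover have "(\<lambda>a. a \<otimes> (r \<otimes> x)) ` carrier R \<noteq> {\<zero>}"
      using in_principal_left_ideal[OF rx(1)] rx(2) by blast
    ultimately have "(\<lambda>a. a \<otimes> (r \<otimes> x)) ` carrier R = S"
      using S principal_left_ideal[OF rx(1)]
      unfolding simple_submodule_def regular_module_simps by metis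
    then have "x \<in> (\<lambda>a. a \<otimes> (r \<otimes> x)) ` carrier R" using x by simp
    then obtain a where a: "x = a \<otimes> (r \<otimes> x)" "a \<in> carrier R" ..
    have "(\<one> \<ominus> a \<otimes> r) \<otimes> x = x \<ominus> a \<otimes> (r \<otimes> x)"
      using a(2) rc xc by (simp add: minus_eq l_distr l_minus m_assoc)
    also have "\<dots> = \<zero>"
      using xc by (simp add: a(1)[symmetric] minus_eq r_neg)
    finally have "\<one> \<ominus> a \<otimes> r \<in> L"
      using L(2) a(2) rc by auto
    moreover have "a \<otimes> r \<in> L" using LD r a by blast
    ultimately have "(\<one> \<ominus> a \<otimes> r) \<oplus> a \<otimes> r \<in> L" using LD(4) by blast
    then have "\<one> \<in> L"
      using a(2) rc by (simp add: minus_eq a_assoc l_neg)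
    then show ?thesis using left_ideal_one L(1) by blast
  qed
  moreover have "?A \<noteq> carrier R" using one one_closed by metis
  ultimately have "maximal_left_ideal ?A R"
    using A unfolding maximal_submodule_def regular_module_simps by blast
  then show ?thesis
    using jacobson_radicalD(2)[OF j] by blast
qed

lemma simple_submodule_exists:
  assumes fin: "finite (carrier R)" and L: "left_ideal L R" "L \<noteq> {\<zero>}"
  obtains S where "simple_submodule S R (regular_module R)" "S \<subseteq> L"
proof -
  let ?P = "\<lambda>S. left_ideal S R \<and> S \<noteq> {\<zero>} \<and> S \<subseteq> L"
  obtain S where S: "?P S" "\<And>N. ?P N \<Longrightarrow> card S \<le> card N"
    using ex_has_least_nat[of ?P L card] L by blast
  have finS: "finite S" using S(1) fin finite_subset left_idealD(2) by blast
  have "simple_submodule S R (regular_module R)"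
    unfolding simple_submodule_def
  proof (intro conjI allI impI)
    fix N assume N: "left_ideal N R \<and> N \<subseteq> S"
    show "N = {\<zero>\<^bsub>regular_module R\<^esub>} \<or> N = S"
    proof (cases "N = {\<zero>}")
      case False
      then have "?P N" using N S(1) by blast
      then show ?thesis using card_seteq[OF finS, of N] S(2) N by blast
    qed simp
  qed (use S in auto)
  then show ?thesis using that S by blast
qed

section \<open>Translates of a faithful character and the size of the socle\<close>

lemma translate_in_add_chars:
  assumes "\<epsilon> \<in> add_chars R" "y \<in> carrier R"
  shows "(\<lambda>x\<in>carrier R. \<epsilon> (x \<otimes> y)) \<in> add_chars R"
  using restrict_in_add_chars[OF character_on_mult(2)[OF assms]] by simp

lemma add_char_diff_eq_1:
  assumes "\<epsilon> \<in> add_chars R" "a \<in> carrier R" "b \<in> carrier R" "\<epsilon> a = \<epsilon> b"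
  shows "\<epsilon> (a \<ominus> b) = 1"
proof -
  have "\<epsilon> (a \<ominus> b) * \<epsilon> b = \<epsilon> a"
    using add_charsD_ring(2)[OF assms(1), of "a \<ominus> b" b] assms(2,3)
    by (simp add: minus_eq a_assoc l_neg)
  then show ?thesis
    using assms(4) add_charsD_ring(1)[OF assms(1,3)] by simp
qed

lemma inj_on_translates:
  assumes \<epsilon>: "\<epsilon> \<in> add_chars R" and f: "faithful_on R (carrier R) \<epsilon>"
  shows "inj_on (\<lambda>y. \<lambda>x\<in>carrier R. \<epsilon> (x \<otimes> y)) (carrier R)"
proof (rule inj_onI)
  fix a b assume a: "a \<in> carrier R" and b: "b \<in> carrier R"
    and eq: "(\<lambda>x\<in>carrier R. \<epsilon> (x \<otimes> a)) = (\<lambda>x\<in>carrier R. \<epsilon> (x \<otimes> b))"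
  have "\<epsilon> (x \<otimes> (a \<ominus> b)) = 1" if x: "x \<in> carrier R" for x
  proof -
    have "\<epsilon> (x \<otimes> a) = \<epsilon> (x \<otimes> b)" using fun_cong[OF eq, of x] x by simp
    then have "\<epsilon> (x \<otimes> a \<ominus> x \<otimes> b) = 1"
      using add_char_diff_eq_1[OF \<epsilon>, of "x \<otimes> a" "x \<otimes> b"] x a b by simp
    then show ?thesis using x a b by (simp add: minus_eq r_distr r_minus)
  qed
  then have "a \<ominus> b = \<zero>"
    using faithful_onD[OF f, of "a \<ominus> b"] a b by simp
  then show "a = b" using a b by simp
qed

text \<open>Faithfulness makes y -> \<open>\<epsilon> (_ \<otimes> y)\<close> injective from R into
  its dual, and the dual has |R| elements.\<close>

lemma add_chars_eq_translates:
  assumes fin: "finite (carrier R)" and \<epsilon>: "\<epsilon> \<in> add_chars R" and f: "faithful_on R (carrier R) \<epsilon>"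
    and \<chi>: "\<chi> \<in> add_chars R"
  obtains y where "y \<in> carrier R" "\<And>x. x \<in> carrier R \<Longrightarrow> \<chi> x = \<epsilon> (x \<otimes> y)"
proof -
  let ?t = "\<lambda>y. \<lambda>x\<in>carrier R. \<epsilon> (x \<otimes> y)"
  have "?t ` carrier R = add_chars R"
    by (rule card_subset_eq[OF finite_add_chars[OF fin]])
      (use translate_in_add_chars[OF \<epsilon>] card_image[OF inj_on_translates[OF \<epsilon> f]] card_add_chars[OF fin]
        in auto)
  then obtain y where "y \<in> carrier R" "\<chi> = ?t y"
    using \<chi> by blast
  then show ?thesis using that by simp
qed


text \<open>If J y = 0, the translate of \<open>\<epsilon>\<close> by y is trivial on J, and only
  |R| / |J| characters are.\<close>

lemma card_left_annihilated_by_jacobson: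
  assumes fin: "finite (carrier R)" and \<epsilon>: "\<epsilon> \<in> add_chars R" and f: "faithful_on R (carrier R) \<epsilon>"
  shows "card {y \<in> carrier R. \<forall>j\<in>jacobson_radical R. j \<otimes> y = \<zero>} * card (jacobson_radical R)
    \<le> card (carrier R)"
proof -
  let ?J = "jacobson_radical R"
  interpret J: ideal ?J R by (rule ideal_jacobson_radical)
  let ?t = "\<lambda>y. \<lambda>x\<in>carrier R. \<epsilon> (x \<otimes> y)"
  let ?A = "{y \<in> carrier R. \<forall>j\<in>?J. j \<otimes> y = \<zero>}"
  let ?K = "{\<chi> \<in> add_chars R. \<forall>t\<in>?J. \<chi> t = 1}"
  have "?t ` ?A \<subseteq> ?K"
    using translate_in_add_chars[OF \<epsilon>] J.Icarr add_char_zero[OF \<epsilon>] by auto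
  moreover have "inj_on ?t ?A"
    using inj_on_translates[OF \<epsilon> f] by (rule inj_on_subset) auto
  ultimately have "card ?A \<le> card ?K"
    using finite_add_chars[OF fin] by (intro card_inj_on_le[of ?t]) auto
  then have "card ?A * card ?J \<le> card ?K * card ?J"
    by (rule mult_le_mono1)
  then show ?thesis
    using card_annihilator[OF fin J.additive_subgroup_axioms] by (simp add: mult.commute)
qed

text \<open>
  A character trivial on the socle is \<open>\<epsilon> (x \<cdot>)\<close> for some \<open>x\<close>. For a maximal left ideal \<open>M\<close> there is
  \<open>y \<noteq> 0\<close> with \<open>M y = 0\<close>; then \<open>y R\<close> lies in the socle, so \<open>x y = 0\<close> and hence \<open>x \<in> M\<close>. Thus \<open>x \<in> J\<close>.
\<close>

lemma card_socle_ge: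
  assumes fin: "finite (carrier R)" and \<epsilon>: "\<epsilon> \<in> add_chars R" and f: "faithful_on R (carrier R) \<epsilon>"
  shows "card (carrier R) \<le> card (socle R (regular_module R)) * card (jacobson_radical R)"
proof -
  let ?J = "jacobson_radical R" and ?S = "socle R (regular_module R)"
  interpret O: ring "opp_ring R" by (rule ring_opp_ring) (rule ring_axioms)
  have fo: "faithful_on (opp_ring R) (carrier R) \<epsilon>"
    by (rule faithful_opp_ring[OF fin \<epsilon> f])
  note SD = a_subgroupD[OF socle_subgroup]
  have "{\<chi> \<in> add_chars R. \<forall>t\<in>?S. \<chi> t = 1} \<subseteq> (\<lambda>y. \<lambda>x\<in>carrier R. \<epsilon> (y \<otimes> x)) ` ?J"
  proof
    fix \<chi> assume "\<chi> \<in> {\<chi> \<in> add_chars R. \<forall>t\<in>?S. \<chi> t = 1}"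
    then have \<chi>: "\<chi> \<in> add_chars R" "\<And>t. t \<in> ?S \<Longrightarrow> \<chi> t = 1" by auto
    obtain x where x: "x \<in> carrier R" "\<And>y. y \<in> carrier R \<Longrightarrow> \<chi> y = \<epsilon> (x \<otimes> y)"
      using O.add_chars_eq_translates[of \<epsilon> \<chi>] fin \<epsilon> fo \<chi>(1) by auto
    have "x \<in> ?J"
    proof (rule jacobson_radicalI[OF x(1)])
      fix M assume M: "maximal_left_ideal M R"
      note MD = left_idealD[OF maximal_left_idealD(1)[OF M]]
      \<comment> \<open>As M is proper, more than the trivial character vanishes on M in the sense
        of being 1 there. The element y that translates \<open>\<epsilon>\<close> into such a
        character is nonzero and satisfies M y = 0.\<close>
      let ?K = "{\<chi> \<in> add_chars R. \<forall>t\<in>M. \<chi> t = 1}"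
      have "card M < card (carrier R)"
        using MD(2) maximal_left_idealD(2)[OF M] fin by (intro psubset_card_mono) auto
      then have "card ?K \<noteq> 1"
        using card_annihilator[OF fin MD(1)] by auto
      moreover have one: "(\<lambda>x\<in>carrier R. 1) \<in> ?K"
        using MD(2) by (auto simp: add_chars_def character_on_def)
      ultimately obtain \<psi> where \<psi>: "\<psi> \<in> ?K" "\<psi> \<noteq> (\<lambda>x\<in>carrier R. 1)"
        by (metis (no_types, lifting) is_singletonI' is_singleton_altdef empty_iff)
      obtain y where y: "y \<in> carrier R" "\<And>x. x \<in> carrier R \<Longrightarrow> \<psi> x = \<epsilon> (x \<otimes> y)"
        using add_chars_eq_translates[OF fin \<epsilon> f, of \<psi>] \<psi>(1) by blast
      have y0: "y \<noteq> \<zero>"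
      proof
        assume "y = \<zero>"
        then have "\<psi> z = 1" if "z \<in> carrier R" for z
          using y(2)[OF that] that add_char_zero[OF \<epsilon>] by simp
        then have "\<psi> = (\<lambda>x\<in>carrier R. 1)"
          using \<psi>(1) by (auto simp: add_chars_def extensional_def fun_eq_iff)
        then show False using \<psi>(2) by simp
      qed
      have My: "m \<otimes> y = \<zero>" if m: "m \<in> M" for m
      proof (rule faithful_onD[OF f])
        have mc: "m \<in> carrier R" using m MD(2) by blast
        then show "m \<otimes> y \<in> carrier R" using y(1) by simp
        show "\<epsilon> (r \<otimes> (m \<otimes> y)) = 1" if r: "r \<in> carrier R" for r
        proof -
          have "\<psi> (r \<otimes> m) = 1" using \<psi>(1) MD(6)[OF r m] by blast
          then show ?thesis using y(2)[of "r \<otimes> m"] r mc y(1) by (simp add: m_assoc)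
        qed
      qed
      have yz: "y \<otimes> z \<in> ?S" if z: "z \<in> carrier R" for z
      proof (cases "y \<otimes> z = \<zero>")
        case True
        then show ?thesis using SD(2) by simp
      next
        case False
        have yzc: "y \<otimes> z \<in> carrier R" using y(1) z by simp
        have "m \<otimes> (y \<otimes> z) = \<zero>" if m: "m \<in> M" for m
          using My[OF m] m_assoc[of m y z] m MD(2) y(1) z by auto
        from simple_subset_socle[OF simple_submodule_principal[OF M yzc False this]]
        show ?thesis using in_principal_left_ideal[OF yzc] by blast
      qed
      have xy: "x \<otimes> y = \<zero>"
      proof -
        have "\<epsilon> (x \<otimes> y \<otimes> z) = 1" if z: "z \<in> carrier R" for z
          using \<chi>(2)[OF yz[OF z]] x y(1) z by (simp add: m_assoc)
        then show ?thesis
          using faithful_onD[OF fo, of "x \<otimes> y"] x(1) y(1) by simp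
      qed
      show "x \<in> M"
      proof (rule ccontr)
        assume "x \<notin> M"
        then obtain m r where mr: "m \<in> M" "r \<in> carrier R" "\<one> = m \<oplus> r \<otimes> x"
          using maximal_left_ideal_sum[OF M x(1) _ one_closed] by blast
        have mc: "m \<in> carrier R" using mr MD(2) by blast
        \<comment> \<open>If x were outside M, both summands of 1 = m + r x would annihilate
          y.\<close>
        have "y = (m \<oplus> r \<otimes> x) \<otimes> y" using l_one[OF y(1)] by (simp only: mr(3)[symmetric])
        also have "\<dots> = m \<otimes> y \<oplus> r \<otimes> (x \<otimes> y)"
          using mc mr(2) x(1) y(1) by (simp add: l_distr m_assoc)
        also have "\<dots> = \<zero>" using My[OF mr(1)] xy mr(2) by simp
        finally show False using y0 by simp
      qed
    qed
    moreover have "\<chi> = (\<lambda>y\<in>carrier R. \<epsilon> (x \<otimes> y))"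
      using x(2) \<chi>(1) by (auto simp: add_chars_def extensional_def fun_eq_iff)
    ultimately show "\<chi> \<in> (\<lambda>y. \<lambda>x\<in>carrier R. \<epsilon> (y \<otimes> x)) ` ?J" by blast
  qed
  moreover have "finite ?J"
    using fin finite_subset[of ?J "carrier R"] jacobson_radicalD(1) by blast
  ultimately have "card {\<chi> \<in> add_chars R. \<forall>t\<in>?S. \<chi> t = 1} \<le> card ?J"
    by (meson card_image_le card_mono finite_imageI le_trans)
  then have "card ?S * card {\<chi> \<in> add_chars R. \<forall>t\<in>?S. \<chi> t = 1} \<le> card ?S * card ?J"
    by (rule mult_le_mono2)
  then show ?thesis
    using card_annihilator[OF fin socle_subgroup] by simp
qed

lemma socle_isomorphic_if_faithful_character:
  assumes fin: "finite (carrier R)" and \<epsilon>: "\<epsilon> \<in> add_chars R" and f: "faithful_on R (carrier R) \<epsilon>"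
  shows "module_isomorphic R ((regular_module R)\<lparr>carrier := socle R (regular_module R)\<rparr>)
     (quotient_module (regular_module R) (jacobson_radical R))"
proof -
  let ?J = "jacobson_radical R" and ?S = "socle R (regular_module R)"
  interpret J: ideal ?J R by (rule ideal_jacobson_radical)
  interpret Q: ring "R Quot ?J" by (rule J.quotient_is_ring)
  obtain \<chi>0 where \<chi>0: "\<chi>0 \<in> add_chars (R Quot ?J)"
    "faithful_on (R Quot ?J) (carrier (R Quot ?J)) \<chi>0"
    using quotient_jacobson_character[OF fin] .
  define \<chi> where "\<chi> = (\<lambda>x\<in>carrier R. \<chi>0 (?J +> x))"
  have Qadd: "?J +> (x \<oplus> y) = (?J +> x) \<oplus>\<^bsub>R Quot ?J\<^esub> (?J +> y)"
    if "x \<in> carrier R" "y \<in> carrier R" for x y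
    using J.a_rcos_sum[OF that] by (simp add: FactRing_def)
  have Qmult: "?J +> (x \<otimes> y) = (?J +> x) \<otimes>\<^bsub>R Quot ?J\<^esub> (?J +> y)"
    if "x \<in> carrier R" "y \<in> carrier R" for x y
    using J.rcoset_mult_add[OF that] by (simp add: FactRing_def)
  have Q0: "\<zero>\<^bsub>R Quot ?J\<^esub> = ?J" by (simp add: FactRing_def)
  have "\<chi> \<in> add_chars R"
    unfolding \<chi>_def
    by (rule restrict_in_add_chars, rule character_onI)
      (use J.coset_in_quotient Qadd Q.add_charsD_ring[OF \<chi>0(1)] in auto)
  then obtain s where s: "s \<in> carrier R" "\<And>x. x \<in> carrier R \<Longrightarrow> \<chi> x = \<epsilon> (x \<otimes> s)"
    using add_chars_eq_translates[OF fin \<epsilon> f] by blast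
  \<comment> \<open>Both directions compare \<open>\<epsilon> (r \<otimes> x \<otimes> s)\<close>
    with the value of \<open>\<chi>0\<close> on the coset of r x: faithfulness of
    \<open>\<epsilon>\<close> gives x s = 0 for x in J, faithfulness of \<open>\<chi>0\<close> gives
    the converse.\<close>
  have kill: "x \<otimes> s = \<zero> \<longleftrightarrow> x \<in> ?J" if x: "x \<in> carrier R" for x
  proof
    assume "x \<in> ?J"
    then have "r \<otimes> x \<in> ?J" if "r \<in> carrier R" for r using J.I_l_closed that by blast
    then have "\<chi> (r \<otimes> x) = 1" if "r \<in> carrier R" for r
      using that x J.coset_eq_iff_zero[of "r \<otimes> x"] Q.add_char_zero[OF \<chi>0(1)]
      by (simp add: \<chi>_def Q0)
    then show "x \<otimes> s = \<zero>"
      using s x by (intro faithful_onD[OF f]) (simp_all add: m_assoc)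
  next
    assume 0: "x \<otimes> s = \<zero>"
    have "?J +> x = \<zero>\<^bsub>R Quot ?J\<^esub>"
    proof (rule faithful_onD[OF \<chi>0(2) J.coset_in_quotient[OF x]])
      fix C assume "C \<in> carrier (R Quot ?J)"
      then obtain r where r: "r \<in> carrier R" "C = ?J +> r" by (rule J.quotient_cases)
      have "\<epsilon> (r \<otimes> x \<otimes> s) = 1"
        using 0 r(1) x s(1) add_char_zero[OF \<epsilon>] by (simp add: m_assoc)
      then show "\<chi>0 (C \<otimes>\<^bsub>R Quot ?J\<^esub> (?J +> x)) = 1"
        using s(2)[of "r \<otimes> x"] r x Qmult[of r x] by (simp add: \<chi>_def)
    qed
    then show "x \<in> ?J" using J.coset_eq_iff_zero[OF x] Q0 by simp
  qed
  \<comment> \<open>The fibre of x -> x s over a s is the coset of a modulo J. Sending a point to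
    its fibre inverts R/J -> R s without choosing representatives.\<close>
  define g where "g y = {x \<in> carrier R. x \<otimes> s = y}" for y
  have g: "g (a \<otimes> s) = ?J +> a" if a: "a \<in> carrier R" for a
  proof -
    have "x \<otimes> s = a \<otimes> s \<longleftrightarrow> x \<in> ?J +> a" if x: "x \<in> carrier R" for x
    proof -
      have "x \<otimes> s = a \<otimes> s \<longleftrightarrow> x \<otimes> s \<ominus> a \<otimes> s = \<zero>"
        using x a s(1) by simp
      also have "\<dots> \<longleftrightarrow> (x \<ominus> a) \<otimes> s = \<zero>"
        using x a s(1) by (simp add: minus_eq l_distr l_minus)
      also have "\<dots> \<longleftrightarrow> x \<in> ?J +> a"
        using kill[of "x \<ominus> a"] J.a_rcos_module_minus[OF ring_axioms a x] x a by simp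
      finally show ?thesis .
    qed
    then show ?thesis
      using a_r_coset_subset_G[OF J.a_subset a] by (auto simp: g_def)
  qed
  let ?Rs = "(\<lambda>r. r \<otimes> s) ` carrier R"
  have bij: "bij_betw g ?Rs (carrier (R Quot ?J))"
  proof (rule bij_betw_imageI)
    show "inj_on g ?Rs"
    proof (rule inj_onI)
      fix y y' assume y: "y \<in> ?Rs" and eq: "g y = g y'"
      from y obtain a where "y = a \<otimes> s" "a \<in> carrier R" ..
      then have "a \<in> g y'" using eq by (auto simp: g_def)
      then show "y = y'" using \<open>y = a \<otimes> s\<close> by (simp add: g_def)
    qed
    show "g ` ?Rs = carrier (R Quot ?J)"
    proof (intro equalityI subsetI)
      show "C \<in> carrier (R Quot ?J)" if "C \<in> g ` ?Rs" for C
        using that g J.coset_in_quotient by auto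
      show "C \<in> g ` ?Rs" if "C \<in> carrier (R Quot ?J)" for C
        using that g by (elim J.quotient_cases) (auto simp: image_image intro!: image_eqI)
    qed
  qed
  have cardRs: "card ?Rs * card ?J = card (carrier R)"
    using a_lagrange[OF fin J.additive_subgroup_axioms] bij_betw_same_card[OF bij]
    by (simp add: FactRing_def order_def)
  \<comment> \<open>Both R s and the socle lie in the set A of elements annihilated by J. Since |A|
    |J| is at most |R| = |R s| |J|, and |R| is at most |Soc| |J|, all three sets coincide.\<close>
  let ?A = "{y \<in> carrier R. \<forall>j\<in>?J. j \<otimes> y = \<zero>}"
  have finJ: "finite ?J" by (rule finite_subset[OF J.a_subset fin])
  then have Jpos: "card ?J > 0" using J.zero_closed card_gt_0_iff by blast
  have finA: "finite ?A" using fin by simp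
  have A: "additive_subgroup ?A R"
    by (rule a_subgroupI) (use J.Icarr in \<open>auto simp: r_distr r_minus\<close>)
  have cardA: "card ?A * card ?J \<le> card (carrier R)"
    by (rule card_left_annihilated_by_jacobson[OF fin \<epsilon> f])
  have "?Rs \<subseteq> ?A"
  proof
    fix y assume "y \<in> ?Rs"
    then obtain r where r: "y = r \<otimes> s" "r \<in> carrier R" ..
    have "j \<otimes> y = \<zero>" if "j \<in> ?J" for j
      using kill[of "j \<otimes> r"] J.I_r_closed[OF that r(2)] J.Icarr[OF that] r s(1)
      by (simp add: m_assoc)
    then show "y \<in> ?A" using r s(1) by simp
  qed
  moreover have "card ?A * card ?J \<le> card ?Rs * card ?J"
    unfolding cardRs by (rule cardA)
  then have "card ?A \<le> card ?Rs"
    unfolding mult_le_cancel2 using Jpos by blast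
  ultimately have RsA: "?Rs = ?A" by (rule card_seteq[OF finA])
  have "?S \<subseteq> ?A"
  proof (rule socle_least[OF A])
    fix T assume T: "simple_submodule T R (regular_module R)"
    then have "T \<subseteq> carrier R" using left_idealD(2) by (auto simp: simple_submodule_def)
    then show "T \<subseteq> ?A" using jacobson_radical_kills_simple[OF T] by blast
  qed
  moreover have "card ?A * card ?J \<le> card ?S * card ?J"
    by (rule le_trans[OF cardA card_socle_ge[OF fin \<epsilon> f]])
  then have "card ?A \<le> card ?S"
    unfolding mult_le_cancel2 using Jpos by blast
  ultimately have "?S = ?A" by (rule card_seteq[OF finA])
  then have S: "?S = ?Rs" using RsA by simp
  show ?thesis
    unfolding module_isomorphic_def
  proof (intro exI[of _ g] conjI ballI)
    show "bij_betw g (carrier ((regular_module R)\<lparr>carrier := ?S\<rparr>))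
        (carrier (quotient_module (regular_module R) ?J))"
      using bij by (simp add: S)
  next
    fix x y assume "x \<in> carrier ((regular_module R)\<lparr>carrier := ?S\<rparr>)"
      "y \<in> carrier ((regular_module R)\<lparr>carrier := ?S\<rparr>)"
    then have "x \<in> ?Rs" "y \<in> ?Rs" by (simp_all add: S)
    then obtain a b where ab: "a \<in> carrier R" "b \<in> carrier R" "x = a \<otimes> s" "y = b \<otimes> s"
      by (elim imageE)
    then have "x \<oplus> y = (a \<oplus> b) \<otimes> s" using s(1) by (simp add: l_distr)
    then show "g (x \<oplus>\<^bsub>(regular_module R)\<lparr>carrier := ?S\<rparr>\<^esub> y)
        = g x \<oplus>\<^bsub>quotient_module (regular_module R) ?J\<^esub> g y"
      using ab Qadd g by simp
  next
    fix r x assume r: "r \<in> carrier R" and "x \<in> carrier ((regular_module R)\<lparr>carrier := ?S\<rparr>)"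
    then have "x \<in> ?Rs" by (simp add: S)
    then obtain a where a: "x = a \<otimes> s" "a \<in> carrier R" ..
    then have "r \<otimes> x = (r \<otimes> a) \<otimes> s" using s(1) r by (simp add: m_assoc)
    then show "g (r \<odot>\<^bsub>(regular_module R)\<lparr>carrier := ?S\<rparr>\<^esub> x)
        = r \<odot>\<^bsub>quotient_module (regular_module R) ?J\<^esub> g x"
      using a r Qmult g J.quotient_smult[OF r J.coset_in_quotient] by simp
  qed
qed

section \<open>Frobenius rings and faithful characters\<close>

lemma finite_artinian_regular:
  assumes "finite (carrier R)"
  shows "artinian_module R (regular_module R)"
  unfolding artinian_module_def
proof (intro allI impI)
  fix S :: "nat \<Rightarrow> 'a set"
  assume S: "\<forall>i. left_ideal (S i) R \<and> S (Suc i) \<subseteq> S i"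
  obtain m where m: "\<And>i. card (S m) \<le> card (S i)"
    using ex_has_least_nat[of "\<lambda>_. True" 0 "\<lambda>i. card (S i)"] by blast
  have "S i = S m" if "i \<ge> m" for i
  proof (rule card_seteq)
    show "finite (S m)"
      using S assms finite_subset left_idealD(2) by blast
    show "S i \<subseteq> S m"
      using lift_Suc_antimono_le[of S] S that by blast
  qed (rule m)
  then show "\<exists>m. \<forall>i\<ge>m. S i = S m" by blast
qed

lemma frobenius_if_faithful_character:
  assumes fin: "finite (carrier R)" and \<epsilon>: "\<epsilon> \<in> add_chars R" and f: "faithful_on R (carrier R) \<epsilon>"
  shows "frobenius_ring R"
proof -
  interpret O: ring "opp_ring R" by (rule ring_opp_ring) (rule ring_axioms)
  show ?thesis
    unfolding frobenius_ring_def
    using finite_artinian_regular[OF fin] O.finite_artinian_regular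
      socle_isomorphic_if_faithful_character[OF fin \<epsilon> f]
      O.socle_isomorphic_if_faithful_character[of \<epsilon>] faithful_opp_ring[OF fin \<epsilon> f]
      fin \<epsilon> ring_axioms jacobson_radical_opp_ring[OF fin]
    by simp
qed

lemma faithful_character_if_frobenius:
  assumes fin: "finite (carrier R)" and F: "frobenius_ring R"
  obtains \<epsilon> where "\<epsilon> \<in> add_chars R" "faithful_on R (carrier R) \<epsilon>"
proof -
  let ?J = "jacobson_radical R" and ?S = "socle R (regular_module R)"
  interpret J: ideal ?J R by (rule ideal_jacobson_radical)
  interpret Q: ring "R Quot ?J" by (rule J.quotient_is_ring)
  note SD = a_subgroupD[OF socle_subgroup]
  obtain \<chi>0 where \<chi>0: "\<chi>0 \<in> add_chars (R Quot ?J)"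
    "faithful_on (R Quot ?J) (carrier (R Quot ?J)) \<chi>0"
    using quotient_jacobson_character[OF fin] .
  obtain h where h: "bij_betw h ?S (carrier (R Quot ?J))"
    and hadd: "\<And>x y. x \<in> ?S \<Longrightarrow> y \<in> ?S \<Longrightarrow> h (x \<oplus> y) = h x \<oplus>\<^bsub>R Quot ?J\<^esub> h y"
    and hsm: "\<And>r x. r \<in> carrier R \<Longrightarrow> x \<in> ?S \<Longrightarrow>
        h (r \<otimes> x) = r \<odot>\<^bsub>quotient_module (regular_module R) ?J\<^esub> h x"
    using F unfolding frobenius_ring_def module_isomorphic_def by auto
  have hc: "h x \<in> carrier (R Quot ?J)" if "x \<in> ?S" for x
    using h that bij_betwE by blast
  have h0: "h \<zero> = \<zero>\<^bsub>R Quot ?J\<^esub>"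
    using hadd[OF SD(2) SD(2)] hc[OF SD(2)] by simp
  have "character_on R ?S (\<lambda>x. \<chi>0 (h x))"
    by (rule character_onI) (use hc hadd Q.add_charsD_ring[OF \<chi>0(1)] in auto)
  then obtain \<epsilon> where \<epsilon>: "\<epsilon> \<in> add_chars R" "\<And>x. x \<in> ?S \<Longrightarrow> \<epsilon> x = \<chi>0 (h x)"
    using character_extend[OF fin socle_subgroup] by metis
  have "faithful_on R (carrier R) \<epsilon>"
    unfolding faithful_on_def
  proof (intro ballI impI)
    fix x assume x: "x \<in> carrier R" "\<forall>r\<in>carrier R. \<epsilon> (r \<otimes> x) = 1"
    show "x = \<zero>"
    proof (rule ccontr)
      assume "x \<noteq> \<zero>"
      then have "(\<lambda>r. r \<otimes> x) ` carrier R \<noteq> {\<zero>}"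
        using in_principal_left_ideal[OF x(1)] by blast
      then obtain T where T: "simple_submodule T R (regular_module R)" "T \<subseteq> (\<lambda>r. r \<otimes> x) ` carrier R"
        using simple_submodule_exists[OF fin principal_left_ideal[OF x(1)]] by blast
      have LT: "left_ideal T R" using T(1) by (simp add: simple_submodule_def)
      note TD = left_idealD[OF LT]
      have TS: "T \<subseteq> ?S" by (rule simple_subset_socle[OF T(1)])
      have "T \<noteq> {\<zero>}" using T(1) by (simp add: simple_submodule_def)
      then obtain y where y: "y \<in> T" "y \<noteq> \<zero>" using TD(3) by blast
      have yS: "y \<in> ?S" using y TS by blast
      \<comment> \<open>As y lies in R x, the character is trivial on R y. Through h this means that
        \<open>\<chi>0\<close> is trivial on all left multiples of \<open>h y\<close>, so
        \<open>h y\<close> is zero although h is injective and y is not zero.\<close>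
      have "h y = \<zero>\<^bsub>R Quot ?J\<^esub>"
      proof (rule faithful_onD[OF \<chi>0(2) hc[OF yS]])
        fix C assume "C \<in> carrier (R Quot ?J)"
        then obtain r where r: "r \<in> carrier R" "C = ?J +> r" by (rule J.quotient_cases)
        have ry: "r \<otimes> y \<in> T" by (rule TD(6)[OF r(1) y(1)])
        then obtain t where "r \<otimes> y = t \<otimes> x" "t \<in> carrier R" using T(2) by blast
        then have "\<epsilon> (r \<otimes> y) = 1" using x(2) by simp
        then show "\<chi>0 (C \<otimes>\<^bsub>R Quot ?J\<^esub> h y) = 1"
          using \<epsilon>(2)[of "r \<otimes> y"] ry TS hsm[OF r(1) yS] J.quotient_smult[OF r(1) hc[OF yS]] r(2)
          by auto
      qed
      then show False
        using h0 y(2) yS SD(2) h by (metis bij_betw_inv_into_left)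
    qed
  qed
  then show ?thesis using that \<epsilon>(1) by blast
qed

end

subsection \<open>The integers modulo n\<close>

lemma cis_root_eq_1_iff:
  assumes "n > 0"
  shows "cis (2 * pi * real_of_int m / real n) = 1 \<longleftrightarrow> int n dvd m"
proof
  assume "int n dvd m"
  then obtain q where "m = int n * q" by (elim dvdE)
  then have "2 * pi * real_of_int m / real n = 2 * pi * real_of_int q"
    using assms by simp
  then show "cis (2 * pi * real_of_int m / real n) = 1"
    by (simp only: cis_multiple_2pi Ints_of_int)
next
  assume 1: "cis (2 * pi * real_of_int m / real n) = 1"
  define r where "r = nat (m mod int n)"
  have r: "r < n" "int r = m mod int n"
    using assms by (simp_all add: r_def nat_less_iff)
  have m: "real_of_int m = real n * real_of_int (m div int n) + real r"
  proof -
    have "m = int n * (m div int n) + int r" using r(2) by simp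
    then show ?thesis by (metis of_int_add of_int_mult of_int_of_nat_eq)
  qed
  have "2 * pi * real_of_int m / real n
      = 2 * pi * real_of_int (m div int n) + 2 * pi * real r / real n"
    using assms unfolding m by (simp add: field_simps)
  then have "cis (2 * pi * real r / real n) = cis (2 * pi * real_of_int m / real n)"
    by (simp add: cis_mult[symmetric])
  moreover have "inj_on (\<lambda>k. cis (2 * pi * real k / real n)) {..<n}"
    using bij_betw_roots_unity[OF assms] by (simp add: bij_betw_def)
  ultimately have "r = 0"
    using 1 inj_onD[of "\<lambda>k. cis (2 * pi * real k / real n)" "{..<n}" r 0] r(1) by simp
  then show "int n dvd m" using r(2) by (simp add: dvd_eq_mod_eq_0)
qed

text \<open>The embedding of Z_n onto the complex n-th roots of unity; for positive n the chosen
  representative does not matter (\<open>ZFact_char_eq\<close>).\<close>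

definition ZFact_char :: "nat \<Rightarrow> int set \<Rightarrow> complex" where
  "ZFact_char n C = cis (2 * pi * real_of_int (SOME k. k \<in> C) / real n)"

lemma ZFact_char_eq:
  assumes "n > 0" "C \<in> carrier (ZFact (int n))" "k \<in> C"
  shows "ZFact_char n C = cis (2 * pi * real_of_int k / real n)"
proof -
  define l where "l = (SOME k. k \<in> C)"
  have "l \<in> C" unfolding l_def by (rule ZFact_class_nonempty[OF assms(2)])
  then have "int n dvd l - k" using ZFact_classD(2)[OF assms(2,3)] by simp
  then have "cis (2 * pi * real_of_int (l - k) / real n) = 1"
    using cis_root_eq_1_iff[OF assms(1)] by blast
  moreover have "2 * pi * real_of_int l / real n
      = 2 * pi * real_of_int (l - k) / real n + 2 * pi * real_of_int k / real n"
    by (simp add: algebra_simps diff_divide_distrib)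
  ultimately show ?thesis
    by (simp add: ZFact_char_def l_def[symmetric] cis_mult[symmetric])
qed

lemma ZFact_char_nonzero: "ZFact_char n C \<noteq> 0"
  by (simp add: ZFact_char_def)

lemma ZFact_char_add:
  assumes n: "n > 0" and C: "C \<in> carrier (ZFact (int n))" and D: "D \<in> carrier (ZFact (int n))"
  shows "ZFact_char n (C \<oplus>\<^bsub>ZFact (int n)\<^esub> D) = ZFact_char n C * ZFact_char n D"
proof -
  interpret K: cring "ZFact (int n)" by (rule ZFact_is_cring)
  obtain k l where kl: "k \<in> C" "l \<in> D"
    using ZFact_class_nonempty C D by blast
  show ?thesis
    using ZFact_char_eq[OF n K.add.m_closed[OF C D] ZFact_class_add_mult(1)[OF C D kl]]
      ZFact_char_eq[OF n C kl(1)] ZFact_char_eq[OF n D kl(2)]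
    by (simp add: cis_mult add_divide_distrib distrib_left)
qed

text \<open>Multiplication by a residue class becomes a power, just as a character turns the
  multiple \<open>[k] \<cdot> x\<close> into a power. This matches scalar action on both
  sides.\<close>

lemma ZFact_char_mult:
  assumes n: "n > 0" and C: "C \<in> carrier (ZFact (int n))" and D: "D \<in> carrier (ZFact (int n))"
    and k: "k \<in> C"
  shows "ZFact_char n (C \<otimes>\<^bsub>ZFact (int n)\<^esub> D) = ZFact_char n D powi k"
proof -
  interpret K: cring "ZFact (int n)" by (rule ZFact_is_cring)
  obtain l where l: "l \<in> D"
    using ZFact_class_nonempty D by blast
  show ?thesis
    using ZFact_char_eq[OF n K.m_closed[OF C D] ZFact_class_add_mult(2)[OF C D k l]]
      ZFact_char_eq[OF n D l]
    by (simp add: cis_power_int mult_ac)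
qed

lemma inj_on_ZFact_char:
  assumes n: "n > 0"
  shows "inj_on (ZFact_char n) (carrier (ZFact (int n)))"
proof (rule inj_onI)
  fix C D assume C: "C \<in> carrier (ZFact (int n))" and D: "D \<in> carrier (ZFact (int n))"
    and eq: "ZFact_char n C = ZFact_char n D"
  obtain k l where kl: "k \<in> C" "l \<in> D"
    using ZFact_class_nonempty C D by blast
  have "cis (2 * pi * real_of_int (k - l) / real n)
      = cis (2 * pi * real_of_int k / real n) / cis (2 * pi * real_of_int l / real n)"
    by (simp add: cis_divide algebra_simps diff_divide_distrib)
  also have "\<dots> = 1"
    using eq ZFact_char_eq[OF n C kl(1)] ZFact_char_eq[OF n D kl(2)] by simp
  finally have "int n dvd k - l"
    using cis_root_eq_1_iff[OF n] by blast
  then have "k \<in> D" using ZFact_classD(2)[OF D kl(2)] by simp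
  then show "C = D" using ZFact_classD(1) C D kl(1) by metis
qed

lemma ZFact_char_surj:
  assumes n: "n > 0" and z: "z ^ n = 1"
  obtains C where "C \<in> carrier (ZFact (int n))" "ZFact_char n C = z"
proof -
  obtain k where k: "z = cis (2 * pi * real k / real n)"
    using bij_betw_imp_surj_on[OF bij_betw_roots_unity[OF n]] z by blast
  let ?C = "Idl\<^bsub>\<Z>\<^esub> {int n} +>\<^bsub>\<Z>\<^esub> int k"
  have C: "?C \<in> carrier (ZFact (int n))"
    by (auto simp: ZFact_defs A_RCOSETS_def')
  have "int k \<in> ?C"
    by (auto simp: a_r_coset_def' int_Idl intro: exI[of _ 0])
  then show ?thesis
    using that[OF C] ZFact_char_eq[OF n C] k by simp
qed

lemma ZFact_char_eq_1:
  assumes n: "n > 0" and C: "C \<in> carrier (ZFact (int n))" and 1: "ZFact_char n C = 1"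
  shows "C = \<zero>\<^bsub>ZFact (int n)\<^esub>"
proof -
  interpret K: cring "ZFact (int n)" by (rule ZFact_is_cring)
  have "ZFact_char n \<zero>\<^bsub>ZFact (int n)\<^esub> = 1"
    using ZFact_char_add[OF n K.zero_closed K.zero_closed] ZFact_char_nonzero by simp
  then show ?thesis
    using inj_onD[OF inj_on_ZFact_char[OF n]] C 1 K.zero_closed by metis
qed

lemma finite_ZFact:
  assumes "n > 0"
  shows "finite (carrier (ZFact (int n)))"
proof -
  have "ZFact_char n C ^ n = 1" for C
    using assms DeMoivre[of "2 * pi * real_of_int (SOME k. k \<in> C) / real n" n]
    by (simp add: ZFact_char_def)
  then have "ZFact_char n ` carrier (ZFact (int n)) \<subseteq> {z. z ^ n = 1}" by blast
  moreover have "finite {z::complex. z ^ n = 1}"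
    using assms by (auto intro!: card_ge_0_finite simp: card_roots_unity_eq)
  ultimately show ?thesis
    using inj_on_ZFact_char[OF assms] inj_on_finite by blast
qed

text \<open>The base ring has to be Frobenius as well. The embedding into the roots of unity is
  itself a faithful character, as r = 1 already shows.\<close>

lemma frobenius_ring_ZFact:
  assumes n: "n > 0"
  shows "frobenius_ring (ZFact (int n))"
proof -
  let ?K = "ZFact (int n)"
  interpret K: cring ?K by (rule ZFact_is_cring)
  let ?\<epsilon> = "restrict (ZFact_char n) (carrier ?K)"
  have "?\<epsilon> \<in> add_chars ?K"
    by (rule K.restrict_in_add_chars, rule character_onI)
      (simp_all add: ZFact_char_nonzero ZFact_char_add[OF n])
  moreover have "faithful_on ?K (carrier ?K) ?\<epsilon>"
    unfolding faithful_on_def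
  proof (intro ballI impI)
    fix x assume x: "x \<in> carrier ?K" "\<forall>r\<in>carrier ?K. ?\<epsilon> (r \<otimes>\<^bsub>?K\<^esub> x) = 1"
    then have "ZFact_char n x = 1"
      using K.l_one[OF x(1)] K.one_closed by (metis restrict_apply')
    then show "x = \<zero>\<^bsub>?K\<^esub>" by (rule ZFact_char_eq_1[OF n x(1)])
  qed
  ultimately show ?thesis
    by (rule K.frobenius_if_faithful_character[OF finite_ZFact[OF n]])
qed

section \<open>Forms over Z_n and faithful characters\<close>

context ring
begin

lemma ring_char_pos:
  assumes "finite (carrier R)"
  shows "ring_char R > 0"
  using add.ord_ge_1[of \<one>] assms unfolding ring_char_def by fastforce

lemma finitely_generated_char_algebra:
  assumes "finite (carrier R)"
  shows "finitely_generated_module (ZFact (int (ring_char R))) (char_algebra R)"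
proof -
  let ?K = "ZFact (int (ring_char R))"
  interpret A: nc_algebra ?K "char_algebra R" by (rule nc_algebra_char_algebra)
  have "\<Inter>{N. submodule N ?K (char_algebra R) \<and> carrier R \<subseteq> N} = carrier R"
    using A.carrier_is_submodule by auto
  then show ?thesis
    unfolding finitely_generated_module_def using assms by (intro exI[of _ "carrier R"]) simp
qed

text \<open>Z_n-linearity is checked after the injective map \<open>ZFact_char\<close>, where
  addition and scalar action become products and powers. A logarithm of a character is thus
  automatically linear.\<close>

lemma dual_module_char_algebraI:
  assumes fin: "finite (carrier R)" and \<chi>: "character_on R (carrier R) \<chi>"
    and h: "\<And>x. x \<in> carrier R \<Longrightarrow> h x \<in> carrier (ZFact (int (ring_char R)))"
    "\<And>x. x \<in> carrier R \<Longrightarrow> ZFact_char (ring_char R) (h x) = \<chi> x"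
  shows "restrict h (carrier R) \<in> dual_module (ZFact (int (ring_char R))) (char_algebra R)"
proof -
  let ?n = "ring_char R"
  let ?K = "ZFact (int ?n)"
  interpret K: cring ?K by (rule ZFact_is_cring)
  note n = ring_char_pos[OF fin]
  have R: "additive_subgroup (carrier R) R" by (simp add: a_subgroupI)
  have "h (x \<oplus> y) = h x \<oplus>\<^bsub>?K\<^esub> h y" if x: "x \<in> carrier R" and y: "y \<in> carrier R" for x y
    by (rule inj_onD[OF inj_on_ZFact_char[OF n]])
      (use x y h character_on_add[OF \<chi> x y] in \<open>simp_all add: ZFact_char_add[OF n]\<close>)
  moreover have "k \<odot>\<^bsub>char_algebra R\<^esub> x \<in> carrier R \<and>
      h (k \<odot>\<^bsub>char_algebra R\<^esub> x) = k \<otimes>\<^bsub>?K\<^esub> h x"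
    if k: "k \<in> carrier ?K" and x: "x \<in> carrier R" for k x
  proof -
    obtain i where i: "i \<in> k" using ZFact_class_nonempty[OF k] by blast
    have kx: "k \<odot>\<^bsub>char_algebra R\<^esub> x = [i] \<cdot> x"
      by (rule char_algebra_smult[OF k i x])
    have "h ([i] \<cdot> x) = k \<otimes>\<^bsub>?K\<^esub> h x"
      by (rule inj_onD[OF inj_on_ZFact_char[OF n]])
        (use k x h in \<open>simp_all add: ZFact_char_mult[OF n k h(1)[OF x] i] character_on_add_pow[OF R \<chi> x]\<close>)
    then show ?thesis using kx x by simp
  qed
  ultimately show ?thesis
    using h(1) by (simp add: dual_module_def)
qed

lemma non_projective_frobenius_if_frobenius:
  assumes fin: "finite (carrier R)" and F: "frobenius_ring R"
  shows "non_projective_frobenius (ZFact (int (ring_char R))) (char_algebra R)"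
proof -
  let ?n = "ring_char R" and ?A = "char_algebra R"
  let ?K = "ZFact (int ?n)"
  interpret O: ring "opp_ring R" by (rule ring_opp_ring) (rule ring_axioms)
  note n = ring_char_pos[OF fin]
  obtain \<epsilon> where \<epsilon>: "\<epsilon> \<in> add_chars R" and f: "faithful_on R (carrier R) \<epsilon>"
    using faithful_character_if_frobenius[OF fin F] .
  \<comment> \<open>The form is the logarithm of \<open>\<epsilon> (x \<otimes> y)\<close>. It
    exists because n annihilates R, so the values of \<open>\<epsilon>\<close> are n-th roots of
    unity.\<close>
  define B where "B x y = inv_into (carrier ?K) (ZFact_char ?n) (\<epsilon> (x \<otimes> y))" for x y
  have im: "\<epsilon> x \<in> ZFact_char ?n ` carrier ?K" if x: "x \<in> carrier R" for x
  proof -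
    have "\<epsilon> x ^ ?n = 1"
      by (rule add_char_pow_eq_1[OF \<epsilon> x]) (rule ring_char_dvd_imp[OF dvd_refl x])
    then show ?thesis by (metis ZFact_char_surj[OF n] image_eqI)
  qed
  have B: "B x y \<in> carrier ?K" "ZFact_char ?n (B x y) = \<epsilon> (x \<otimes> y)"
    if "x \<in> carrier R" "y \<in> carrier R" for x y
    using im[of "x \<otimes> y"] that by (simp_all add: B_def inv_into_into f_inv_into_f)
  have "bilinear_form ?K ?A B"
    unfolding bilinear_form_def form_alpha_def form_beta_def char_algebra_simps
  proof (intro conjI ballI)
    fix b assume b: "b \<in> carrier R"
    show "(\<lambda>b'\<in>carrier R. B b b') \<in> dual_module ?K ?A"
      by (rule dual_module_char_algebraI[OF fin character_on_mult(1)[OF \<epsilon> b subset_refl]])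
        (use B b in auto)
    show "(\<lambda>b'\<in>carrier R. B b' b) \<in> dual_module ?K ?A"
      by (rule dual_module_char_algebraI[OF fin character_on_mult(2)[OF \<epsilon> b subset_refl]])
        (use B b in auto)
  qed
  moreover have "associative_form ?A B"
    by (simp add: associative_form_def B_def m_assoc)
  moreover have "inj_on (form_beta ?A B) (carrier R)"
  proof (rule inj_onI)
    fix x y assume xy: "x \<in> carrier R" "y \<in> carrier R" and eq: "form_beta ?A B x = form_beta ?A B y"
    have "\<epsilon> (b \<otimes> x) = \<epsilon> (b \<otimes> y)" if b: "b \<in> carrier R" for b
      using fun_cong[OF eq, of b] B(2)[OF b xy(1)] B(2)[OF b xy(2)] b by (simp add: form_beta_def)
    then have "(\<lambda>b\<in>carrier R. \<epsilon> (b \<otimes> x)) = (\<lambda>b\<in>carrier R. \<epsilon> (b \<otimes> y))"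
      by (rule restrict_ext)
    then show "x = y" using inj_onD[OF inj_on_translates[OF \<epsilon> f]] xy by blast
  qed
  \<comment> \<open>Injectivity in the other argument is faithfulness of \<open>\<epsilon>\<close>
    over the opposite ring.\<close>
  moreover have "inj_on (form_alpha ?A B) (carrier R)"
  proof (rule inj_onI)
    fix x y assume xy: "x \<in> carrier R" "y \<in> carrier R" and eq: "form_alpha ?A B x = form_alpha ?A B y"
    have "\<epsilon> (x \<otimes> b) = \<epsilon> (y \<otimes> b)" if b: "b \<in> carrier R" for b
      using fun_cong[OF eq, of b] B(2)[OF xy(1) b] B(2)[OF xy(2) b] b by (simp add: form_alpha_def)
    then have "(\<lambda>b\<in>carrier R. \<epsilon> (x \<otimes> b)) = (\<lambda>b\<in>carrier R. \<epsilon> (y \<otimes> b))"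
      by (rule restrict_ext)
    then show "x = y"
      using inj_onD[OF O.inj_on_translates[of \<epsilon>], of x y] faithful_opp_ring[OF fin \<epsilon> f] \<epsilon> xy by simp
  qed
  ultimately show ?thesis
    unfolding non_projective_frobenius_def non_degenerate_form_def char_algebra_simps
    using frobenius_ring_ZFact[OF n] nc_algebra_char_algebra finitely_generated_char_algebra[OF fin]
    by blast
qed

lemma frobenius_if_non_projective_frobenius:
  assumes fin: "finite (carrier R)"
    and F: "non_projective_frobenius (ZFact (int (ring_char R))) (char_algebra R)"
  shows "frobenius_ring R"
proof -
  let ?n = "ring_char R" and ?A = "char_algebra R"
  let ?K = "ZFact (int ?n)"
  note n = ring_char_pos[OF fin]
  obtain B where bil: "bilinear_form ?K ?A B" and assoc: "associative_form ?A B"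
    and nd: "non_degenerate_form ?A B"
    using F by (auto simp: non_projective_frobenius_def)
  have alpha: "form_alpha ?A B b \<in> dual_module ?K ?A" if "b \<in> carrier R" for b
    using bil that by (simp add: bilinear_form_def)
  have Bc: "B x y \<in> carrier ?K" if "x \<in> carrier R" "y \<in> carrier R" for x y
    using alpha[OF that(1)] that(2) by (auto simp: dual_module_def form_alpha_def)
  have Badd: "B x (y \<oplus> z) = B x y \<oplus>\<^bsub>?K\<^esub> B x z"
    if "x \<in> carrier R" "y \<in> carrier R" "z \<in> carrier R" for x y z
    using alpha[OF that(1)] that by (auto simp: dual_module_def form_alpha_def)
  \<comment> \<open>Associativity gives B r x = B 1 (r x), so the functional B 1 determines the
    whole form.\<close>
  define \<epsilon> where "\<epsilon> = (\<lambda>x\<in>carrier R. ZFact_char ?n (B \<one> x))"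
  have \<epsilon>: "\<epsilon> \<in> add_chars R"
    unfolding \<epsilon>_def
    by (rule restrict_in_add_chars, rule character_onI)
      (simp_all add: ZFact_char_nonzero Badd ZFact_char_add[OF n] Bc)
  have B_\<epsilon>: "ZFact_char ?n (B r x) = \<epsilon> (r \<otimes> x)" if "r \<in> carrier R" "x \<in> carrier R" for r x
  proof -
    have "B (\<one> \<otimes> r) x = B \<one> (r \<otimes> x)"
      using assoc that unfolding associative_form_def char_algebra_simps by blast
    then show ?thesis using that by (simp add: \<epsilon>_def)
  qed
  have "faithful_on R (carrier R) \<epsilon>"
    unfolding faithful_on_def
  proof (intro ballI impI)
    fix x assume x: "x \<in> carrier R" "\<forall>r\<in>carrier R. \<epsilon> (r \<otimes> x) = 1"
    \<comment> \<open>If \<open>\<epsilon>\<close> is trivial on R x, then x and 0 have the same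
      image under \<open>form_beta\<close>, which is injective.\<close>
    have "B r x = B r \<zero>" if r: "r \<in> carrier R" for r
      by (rule inj_onD[OF inj_on_ZFact_char[OF n]])
        (use r x Bc B_\<epsilon> add_char_zero[OF \<epsilon>] in simp_all)
    then have "form_beta ?A B x = form_beta ?A B \<zero>"
      unfolding form_beta_def char_algebra_simps by (rule restrict_ext)
    then show "x = \<zero>"
      using nd x(1) inj_onD[of "form_beta ?A B" "carrier R" x \<zero>] by (simp add: non_degenerate_form_def)
  qed
  then show ?thesis
    by (rule frobenius_if_faithful_character[OF fin \<epsilon>])
qed

end

theorem corollary20:
  fixes R :: "('a, 'm) ring_scheme" and n :: nat
  assumes "ring R" and "finite (carrier R)" and "ring_char R = n"
  shows "frobenius_ring R \<longleftrightarrow>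
         non_projective_frobenius (ZFact (int n)) (char_algebra R)"
  using ring.non_projective_frobenius_if_frobenius[OF assms(1,2)]
    ring.frobenius_if_non_projective_frobenius[OF assms(1,2)] assms(3)
  by blast

end
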